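(* Let $p=p(n)\in[0,1]$ satisfy $p\gg\sqrt{\log n/n}$, and let $G\sim G(n,n,p)$. Then asymptotically almost surely (with probability tending to $1$ as $n\to\infty$), every red--blue edge-colouring of $G$ admits a cover of its vertex set $V(G)$ by at most three monochromatic connected components.
   Context: $G(n,n,p)$ is the random bipartite graph with parts $A$ and $B$, $|A|=|B|=n$, in which each of the $n^2$ pairs $ab$ with $a\in A$, $b\in B$ is an edge independently with probability $p$. The notation $p\gg\sqrt{\log n/n}$ means $p(n)/\sqrt{\log n/n}\to\infty$ as $n\to\infty$. A red--blue edge-colouring assigns to each edge one of the colours red, blue (arbitrarily; it may depend on $G$). A monochromatic connected component is a connected component of the spanning subgraph of $G$ (on vertex set $V(G)$) formed by all red edges, or of the one formed by all blue edges; single vertices are allowed. Components cover $V(G)$ if every vertex belongs to at least one of them; they need not be disjoint and may have different colours. *)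

theory Defs
  imports "HOL-Probability.Probability"
begin

text \<open>A graph is given by its vertex set and its set of edges, which are two-element sets of
  vertices. The parts of the bipartite graph are the left and right copies of \<open>{..<n}\<close>.\<close>

definition bip_verts :: "nat \<Rightarrow> (nat + nat) set" where
  "bip_verts n = {..<n} <+> {..<n}"

definition bip_pairs :: "nat \<Rightarrow> (nat + nat) set set" where
  "bip_pairs n = {{Inl a, Inr b} | a b. a < n \<and> b < n}"

text \<open>The distribution of the edge set of the random bipartite graph: one independent
  Bernoulli trial per pair. The value \<^term>\<open>False\<close> is only the dummy value of the
  product outside its index set.\<close>

definition random_bip_graph :: "nat \<Rightarrow> real \<Rightarrow> (nat + nat) set set pmf" where
  "random_bip_graph n p =
     map_pmf (\<lambda>f. {e \<in> bip_pairs n. f e})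
       (Pi_pmf (bip_pairs n) False (\<lambda>_. bernoulli_pmf p))"

definition joined :: "'v set \<Rightarrow> 'v set set \<Rightarrow> ('v \<times> 'v) set" where
  "joined V E = {(u, v). u \<in> V \<and> v \<in> V \<and> (u, v) \<in> {(x, y). {x, y} \<in> E}\<^sup>*}"

text \<open>Components are represented by their vertex sets; an isolated vertex is a component.\<close>

definition graph_components :: "'v set \<Rightarrow> 'v set set \<Rightarrow> 'v set set" where
  "graph_components V E = V // joined V E"

datatype colour = Red | Blue

definition mono_components ::
  "'v set \<Rightarrow> 'v set set \<Rightarrow> ('v set \<Rightarrow> colour) \<Rightarrow> 'v set set" where
  "mono_components V E c = (\<Union>k. graph_components V {e \<in> E. c e = k})"

definition mono_coverable ::
  "nat \<Rightarrow> 'v set \<Rightarrow> 'v set set \<Rightarrow> ('v set \<Rightarrow> colour) \<Rightarrow> bool" where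
  "mono_coverable m V E c \<longleftrightarrow>
     (\<exists>K \<subseteq> mono_components V E c. finite K \<and> card K \<le> m \<and> V \<subseteq> \<Union>K)"

end

theory Submission
  imports Defs
begin

text \<open>
  Label every vertex by its red and its blue component, so that adjacent vertices share a label. If
  two vertices on the same side differ in both labels, then each of their common neighbours takes
  one label from either of them. In the random graph, the vertices adjacent both to a vertex \<open>x\<close> and
  to some element of a set \<open>S\<close> on the side of \<open>x\<close> are many more than the elements of \<open>S\<close>, until \<open>S\<close>
  has \<open>t = \<lceil>3 ln n / p\<rceil>\<close> elements; from this size on, any two sets on different sides
  are joined by an edge. So a nonempty family of label combinations that keeps reproducing itself
  through common neighbours must contain many vertices.

  That any two sets of size \<open>t\<close> are joined forces one of three global pictures, up to fewer than
  \<open>8t\<close> exceptional vertices per side: (i) one component contains everything; (ii) one side lies in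
  the intersection of a red and a blue component; (iii) the sides are halved and the four blocks
  between the halves are coloured alternately. In (ii) two components cover the other side, and the
  vertices that they miss pairwise share a component, hence all lie in one. In (i) and (iii) the
  exceptional vertices are too few to contain a self-reproducing family, and this restricts their
  labels so much that three components suffice.
\<close>

subsection \<open>Expanding labelled bipartite graphs\<close>

text \<open>Every label counts, attained or not, so empty classes exist and any label names a class
  without a side condition.\<close>

definition classes :: "('v \<Rightarrow> 'c) \<Rightarrow> ('v \<Rightarrow> 'c) \<Rightarrow> 'v set set" where
  "classes r s = range (\<lambda>i. r -` {i}) \<union> range (\<lambda>j. s -` {j})"

definition three_coverable :: "'v set \<Rightarrow> ('v \<Rightarrow> 'c) \<Rightarrow> ('v \<Rightarrow> 'c) \<Rightarrow> bool" where
  "three_coverable V r s \<longleftrightarrow>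
     (\<exists>X\<in>classes r s. \<exists>Y\<in>classes r s. \<exists>Z\<in>classes r s. V \<subseteq> X \<union> Y \<union> Z)"

lemma classes_commute: "classes s r = classes r s"
  by (simp add: classes_def Un_commute)

lemma vimage_in_classes [simp]: "r -` {i} \<in> classes r s" "s -` {i} \<in> classes r s"
  by (auto simp: classes_def)

lemma three_coverableI:
  assumes "X \<in> classes r s" "Y \<in> classes r s" "Z \<in> classes r s" "V \<subseteq> X \<union> Y \<union> Z"
  shows "three_coverable V r s"
  using assms by (auto simp: three_coverable_def)

text \<open>Read the label pair of a vertex as an edge of a bipartite graph. Pairwise intersecting
  edges form a star or a triangle, and a bipartite graph has no triangle.\<close>

lemma intersecting_in_class:
  assumes "\<And>x y. x \<in> Q \<Longrightarrow> y \<in> Q \<Longrightarrow> r x = r y \<or> s x = s y"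
  shows "(\<exists>i. Q \<subseteq> r -` {i}) \<or> (\<exists>j. Q \<subseteq> s -` {j})"
proof (rule ccontr)
  assume neg: "\<not> ?thesis"
  then obtain q where q: "q \<in> Q"
    by blast
  have "\<not> Q \<subseteq> r -` {r q}" "\<not> Q \<subseteq> s -` {s q}"
    using neg by simp_all
  then obtain x y where xy: "x \<in> Q" "r x \<noteq> r q" "y \<in> Q" "s y \<noteq> s q"
    by auto
  then have "s x = s q" "r y = r q"
    using assms q by blast+
  then show False
    using assms[of x y] xy by simp
qed

text \<open>All that is used of the random graph, with \<open>r\<close> and \<open>s\<close> as red
  and blue components. Exceptional sets stay below \<open>8 * t\<close>, so inside them the
  truncation at \<open>t\<close> is never reached and growth by the factor 8 is genuine.\<close>

locale expanding_labelling =
  fixes A B :: "'v set" and adj :: "'v \<Rightarrow> 'v \<Rightarrow> bool" and r s :: "'v \<Rightarrow> 'c" and t :: nat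
  assumes finite_parts: "finite A" "finite B"
    and adj_sym: "adj x y \<Longrightarrow> adj y x"
    and share: "a \<in> A \<Longrightarrow> b \<in> B \<Longrightarrow> adj a b \<Longrightarrow> r a = r b \<or> s a = s b"
    and t_pos: "0 < t"
    and t_less: "t < card A" "t < card B"
    and expandA: "x \<in> A \<Longrightarrow> S \<subseteq> A - {x} \<Longrightarrow>
      8 * min (card S) t \<le> card {b \<in> B. adj x b \<and> (\<exists>y\<in>S. adj y b)}"
    and expandB: "x \<in> B \<Longrightarrow> S \<subseteq> B - {x} \<Longrightarrow>
      8 * min (card S) t \<le> card {a \<in> A. adj x a \<and> (\<exists>y\<in>S. adj y a)}"
    and cross: "X \<subseteq> A \<Longrightarrow> Y \<subseteq> B \<Longrightarrow> t \<le> card X \<Longrightarrow> t \<le> card Y \<Longrightarrow>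
      \<exists>x\<in>X. \<exists>y\<in>Y. adj x y"
begin

lemma swap_parts: "expanding_labelling B A adj r s t"
proof
  fix X Y assume *: "X \<subseteq> B" "Y \<subseteq> A" "t \<le> card X" "t \<le> card Y"
  show "\<exists>x\<in>X. \<exists>y\<in>Y. adj x y"
    using cross[OF *(2,1,4,3)] adj_sym by blast
next
  fix a b assume "a \<in> B" "b \<in> A" "adj a b"
  then show "r a = r b \<or> s a = s b"
    using share[of b a] adj_sym[of a b] by metis
qed (fact finite_parts adj_sym t_pos t_less expandA expandB)+

lemma swap_labels: "expanding_labelling A B adj s r t"
proof
  fix a b assume "a \<in> A" "b \<in> B" "adj a b"
  then show "s a = s b \<or> r a = r b"
    using share[of a b] by blast
qed (fact finite_parts adj_sym t_pos t_less expandA expandB cross)+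

text \<open>A common neighbour of two vertices that differ in both labels combines the first label of
  one with the second label of the other.\<close>

lemma growth:
  assumes "x \<in> A" "S \<subseteq> A" "W \<subseteq> B" "card W < 8 * t"
    and "\<And>y. y \<in> S \<Longrightarrow> r x \<noteq> r y \<and> s x \<noteq> s y"
    and "\<And>y b. y \<in> S \<Longrightarrow> b \<in> B \<Longrightarrow> r b = r x \<and> s b = s y \<or> r b = r y \<and> s b = s x \<Longrightarrow> b \<in> W"
  shows "8 * card S \<le> card W"
proof -
  have "S \<subseteq> A - {x}"
    using assms(2,5) by blast
  then have "8 * min (card S) t \<le> card {b \<in> B. adj x b \<and> (\<exists>y\<in>S. adj y b)}"
    using expandA assms(1) by blast
  also have "\<dots> \<le> card W"
  proof (rule card_mono)
    show "finite W"
      using assms(3) finite_parts finite_subset by blast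
    show "{b \<in> B. adj x b \<and> (\<exists>y\<in>S. adj y b)} \<subseteq> W"
    proof safe
      fix b y assume b: "b \<in> B" "adj x b" "y \<in> S" "adj y b"
      then have "r x = r b \<or> s x = s b" "r y = r b \<or> s y = s b"
        using share assms(1,2) by blast+
      then show "b \<in> W"
        using assms(5)[of y] assms(6)[of y b] b by metis
    qed
  qed
  \<comment> \<open>\<open>card W < 8 * t\<close> rules out that the minimum is
    \<open>t\<close>.\<close>
  finally show ?thesis
    using assms(4) by (simp add: min_def split: if_splits)
qed

lemma common_neighbour:
  assumes "x \<in> A" "y \<in> A" "r x \<noteq> r y" "s x \<noteq> s y"
  obtains b where "b \<in> B" "r b = r x \<and> s b = s y \<or> r b = r y \<and> s b = s x"
proof -
  define W where "W = {b \<in> B. r b = r x \<and> s b = s y \<or> r b = r y \<and> s b = s x}"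
  have "W \<noteq> {}"
  proof
    assume W: "W = {}"
    then have "card W < 8 * t"
      using t_pos by simp
    then have "8 * card {y} \<le> card W"
      by (intro growth[of x]) (use assms in \<open>auto simp: W_def\<close>)
    then show False
      using W by simp
  qed
  then show ?thesis
    using that W_def by blast
qed

lemma degree_ge:
  assumes "x \<in> A"
  shows "8 * t \<le> card {b \<in> B. adj x b}"
proof -
  have "t \<le> card (A - {x})"
    using t_less(1) assms finite_parts by (simp add: card_Diff_singleton)
  then have "8 * t \<le> card {b \<in> B. adj x b \<and> (\<exists>y\<in>A - {x}. adj y b)}"
    using expandA[OF assms order_refl] by (simp only: min_absorb2)
  also have "\<dots> \<le> card {b \<in> B. adj x b}"
    using finite_parts by (intro card_mono) auto
  finally show ?thesis .
qed

text \<open>With at least \<open>8 * t\<close> neighbours, \<open>x\<close> has one among the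
  typical vertices \<open>P\<close>. This carries knowledge about typical vertices over to all
  vertices of the other side.\<close>

lemma neighbour_in:
  assumes "x \<in> A" "card (B - P) < 8 * t"
  obtains b where "b \<in> B" "b \<in> P" "r x = r b \<or> s x = s b"
proof -
  have "\<not> {b \<in> B. adj x b} \<subseteq> B - P"
  proof
    assume "{b \<in> B. adj x b} \<subseteq> B - P"
    then have "card {b \<in> B. adj x b} \<le> card (B - P)"
      using finite_parts by (intro card_mono) auto
    then show False
      using assms(2) degree_ge[OF assms(1)] by simp
  qed
  then show ?thesis
    using that share[OF assms(1)] by blast
qed

text \<open>Two vertices of \<open>B\<close> missed by \<open>X\<close> and \<open>Y\<close> and
  differing in both labels would have a common neighbour made of their labels; it lies in
  \<open>X\<close> or \<open>Y\<close>, hence so does one of the two. So the missed vertices share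
  labels pairwise and fit into one class.\<close>

lemma three_coverable_if_two_cover_part:
  assumes "X \<in> classes r s" "Y \<in> classes r s" "A \<subseteq> X \<union> Y"
  shows "three_coverable (A \<union> B) r s"
proof -
  interpret swap: expanding_labelling B A adj r s t
    by (rule swap_parts)
  have "r x = r y \<or> s x = s y" if xy: "x \<in> B - (X \<union> Y)" "y \<in> B - (X \<union> Y)" for x y
  proof (rule ccontr)
    assume "\<not> (r x = r y \<or> s x = s y)"
    then have *: "x \<in> B" "y \<in> B" "r x \<noteq> r y" "s x \<noteq> s y"
      using xy by auto
    obtain a where a: "a \<in> A" "r a = r x \<and> s a = s y \<or> r a = r y \<and> s a = s x"
      by (rule swap.common_neighbour[OF *])
    then have "a \<in> X \<or> a \<in> Y"
      using assms(3) by blast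
    then show False
      using a(2) xy assms(1,2) by (auto simp: classes_def)
  qed
  then have "(\<exists>i. B - (X \<union> Y) \<subseteq> r -` {i}) \<or> (\<exists>j. B - (X \<union> Y) \<subseteq> s -` {j})"
    by (rule intersecting_in_class)
  then obtain Z where "Z \<in> classes r s" "B - (X \<union> Y) \<subseteq> Z"
    by (elim disjE exE) (blast intro: vimage_in_classes)+
  then show ?thesis
    using assms by (intro three_coverableI[of X r s Y Z]) blast+
qed

end

subsection \<open>One dominant component\<close>

context expanding_labelling
begin

text \<open>The larger exceptional set is squeezed into two classes. Then each failing cover
  supplies a vertex, until families on the two sides would have to outgrow each other.\<close>

lemma three_coverable_if_dominant_class_aux:
  assumes exA: "card (A - r -` {i}) < 8 * t" and exB: "card (B - r -` {i}) < 8 * t"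
    and le: "card (B - r -` {i}) \<le> card (A - r -` {i})"
  shows "three_coverable (A \<union> B) r s"
proof (rule ccontr)
  assume neg: "\<not> three_coverable (A \<union> B) r s"
  interpret swap: expanding_labelling B A adj r s t
    by (rule swap_parts)
  have no2A: "\<not> A \<subseteq> X \<union> Y" if "X \<in> classes r s" "Y \<in> classes r s" for X Y
    using three_coverable_if_two_cover_part[OF that] neg by blast
  have no3: "\<exists>v\<in>A \<union> B. v \<notin> X \<and> v \<notin> Y \<and> v \<notin> Z"
    if "X \<in> classes r s" "Y \<in> classes r s" "Z \<in> classes r s" for X Y Z
    using three_coverableI[OF that] neg by blast
  define EA EB where "EA = A - r -` {i}" and "EB = B - r -` {i}"
  have fin [simp]: "finite A" "finite B" "finite EA" "finite EB"
    using finite_parts by (auto simp: EA_def EB_def)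
  have small: "card W < 8 * t" if "W \<subseteq> EA \<or> W \<subseteq> EB" for W
    using that exA exB card_mono[of EA W] card_mono[of EB W] by (fastforce simp: EA_def EB_def)
  \<comment> \<open>Each exceptional vertex of \<open>A\<close> shares a label with almost all others, since the vertices
    sharing none with it have many more common neighbours with it, all lying in the smaller set \<open>EB\<close>.\<close>
  have "\<exists>j k. EA \<subseteq> r -` {j} \<union> s -` {k}"
  proof (cases "\<forall>x\<in>EA. \<forall>y\<in>EA. r x = r y \<or> s x = s y")
    case True
    then have "(\<exists>j. EA \<subseteq> r -` {j}) \<or> (\<exists>k. EA \<subseteq> s -` {k})"
      by (intro intersecting_in_class) blast
    then show ?thesis
      by blast
  next
    case False
    then obtain x y where xy: "x \<in> EA" "y \<in> EA" "r x \<noteq> r y" "s x \<noteq> s y"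
      by blast
    define D where "D = (\<lambda>z. {w \<in> EA. r z \<noteq> r w \<and> s z \<noteq> s w})"
    have few: "8 * card (D z) \<le> card EB" if "z \<in> EA" for z
      by (rule growth[of z]) (use that small[of EB] in \<open>auto simp: D_def EA_def EB_def\<close>)
    \<comment> \<open>Vertices sharing a label with both \<open>x\<close> and \<open>y\<close> have
      one of two mixed label pairs. As \<open>D x\<close> and \<open>D y\<close> hold at most an
      eighth of \<open>EA\<close> each, some mixed pair holds more than an eighth.\<close>
    define P where "P = (\<lambda>j k. {w \<in> EA. r w = j \<and> s w = k})"
    have "card EA \<le> card (D x \<union> D y \<union> P (r x) (s y) \<union> P (r y) (s x))"
      using xy by (intro card_mono) (auto simp: D_def P_def)
    also have "\<dots> \<le> card (D x) + card (D y) + card (P (r x) (s y)) + card (P (r y) (s x))"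
      by (meson add_mono card_Un_le le_refl order_trans)
    finally have "card EA \<le> card (D x) + card (D y) + card (P (r x) (s y)) + card (P (r y) (s x))" .
    moreover have "0 < card EA"
      using xy by (auto simp: card_gt_0_iff)
    moreover have "8 * card (D x) \<le> card EA" "8 * card (D y) \<le> card EA"
      using few[OF xy(1)] few[OF xy(2)] le by (simp_all add: EA_def EB_def)
    ultimately have "card EA < 8 * card (P (r x) (s y)) \<or> card EA < 8 * card (P (r y) (s x))"
      by linarith
    then obtain j k where jk: "card EA < 8 * card (P j k)"
      by (elim disjE)
    have "z \<in> r -` {j} \<union> s -` {k}" if z: "z \<in> EA" for z
    proof (rule ccontr)
      assume "z \<notin> r -` {j} \<union> s -` {k}"
      then have "card (P j k) \<le> card (D z)"
        by (intro card_mono) (auto simp: D_def P_def)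
      then show False
        using few[OF z] jk le by (simp add: EA_def EB_def)
    qed
    then show ?thesis
      by blast
  qed
  then obtain j k where jk: "EA \<subseteq> r -` {j} \<union> s -` {k}"
    by blast
  then have A_cover: "r a = i \<or> r a = j \<or> s a = k" if "a \<in> A" for a
    using that by (auto simp: EA_def)
  \<comment> \<open>A common neighbour of vertices in \<open>X\<close> and \<open>Y\<close> lies in
    \<open>Q\<close> or \<open>N\<close>, and one of vertices in \<open>Q\<close> and
    \<open>N\<close> lies in \<open>X\<close> or \<open>Y\<close>.\<close>
  define X where "X = {a \<in> A. r a \<noteq> i \<and> r a \<noteq> j \<and> s a = k}"
  define Y where "Y = {a \<in> A. r a \<noteq> i \<and> r a = j \<and> s a \<noteq> k}"
  define Q where "Q = {b \<in> B. r b \<noteq> i \<and> r b \<noteq> j \<and> s b \<noteq> k}"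
  define N where "N = {b \<in> B. r b \<noteq> i \<and> r b = j \<and> s b = k}"
  have sub: "X \<subseteq> EA" "Y \<subseteq> EA" "Q \<subseteq> EB" "N \<subseteq> EB" "Q \<union> N \<subseteq> EB" "X \<union> Y \<subseteq> EA"
    by (auto simp: X_def Y_def Q_def N_def EA_def EB_def)
  note cards = small[OF disjI1[OF sub(1)]] small[OF disjI1[OF sub(2)]] small[OF disjI2[OF sub(3)]]
    small[OF disjI2[OF sub(5)]] small[OF disjI1[OF sub(6)]]
  have fin' [simp]: "finite X" "finite Y" "finite Q" "finite N"
    by (auto simp: X_def Y_def Q_def N_def)
  obtain x0 where x0: "x0 \<in> X"
    using no2A[of "r -` {i}" "r -` {j}"] A_cover by (auto simp: X_def)
  obtain y0 where y0: "y0 \<in> Y"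
    using no2A[of "r -` {i}" "s -` {k}"] A_cover by (auto simp: Y_def)
  obtain q0 where q0: "q0 \<in> Q"
    using no3[of "r -` {i}" "r -` {j}" "s -` {k}"] A_cover by (auto simp: Q_def)
  \<comment> \<open>If \<open>N\<close> is nonempty, then \<open>X \<union> Y\<close> in \<open>A\<close> and \<open>Q \<union> N\<close> in \<open>B\<close> reproduce each other.\<close>
  have "N = {}"
  proof (rule ccontr)
    assume "N \<noteq> {}"
    then obtain b0 where b0: "b0 \<in> N"
      by blast
    have "8 * card Y \<le> card (Q \<union> N)"
      by (rule growth[of x0]) (use cards x0 in \<open>auto simp: X_def Y_def Q_def N_def\<close>)
    moreover have "8 * card X \<le> card (Q \<union> N)"
      by (rule growth[of y0]) (use cards y0 in \<open>auto simp: X_def Y_def Q_def N_def\<close>)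
    moreover have "8 * card N \<le> card (X \<union> Y)"
      by (rule swap.growth[of q0]) (use cards q0 in \<open>auto simp: X_def Y_def Q_def N_def\<close>)
    moreover have "8 * card Q \<le> card (X \<union> Y)"
      by (rule swap.growth[of b0]) (use cards b0 in \<open>auto simp: X_def Y_def Q_def N_def\<close>)
    moreover have "card (Q \<union> N) \<le> card Q + card N" "card (X \<union> Y) \<le> card X + card Y"
      by (rule card_Un_le)+
    moreover have "0 < card X"
      using x0 by (auto simp: card_gt_0_iff)
    ultimately show False
      by linarith
  qed
  \<comment> \<open>\<open>y0\<close> witnesses \<open>j \<noteq> i\<close>, so the condition on
    \<open>i\<close> in \<open>N\<close> is automatic.\<close>
  then have no_N: "\<not> (r b = j \<and> s b = k)" if "b \<in> B" for b
    using that y0 by (auto simp: N_def Y_def)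
  \<comment> \<open>A common neighbour would mix labels avoiding \<open>i\<close>, \<open>j\<close>
    and \<open>k\<close>, against \<open>A_cover\<close>.\<close>
  have "r x = r y \<or> s x = s y" if xy: "x \<in> Q" "y \<in> Q" for x y
  proof (rule ccontr)
    assume "\<not> (r x = r y \<or> s x = s y)"
    then have *: "x \<in> B" "y \<in> B" "r x \<noteq> r y" "s x \<noteq> s y"
      using xy by (auto simp: Q_def)
    obtain a where "a \<in> A" "r a = r x \<and> s a = s y \<or> r a = r y \<and> s a = s x"
      by (rule swap.common_neighbour[OF *])
    then show False
      using A_cover[of a] xy by (auto simp: Q_def)
  qed
  then have "(\<exists>l. Q \<subseteq> r -` {l}) \<or> (\<exists>l. Q \<subseteq> s -` {l})"
    by (rule intersecting_in_class)
  \<comment> \<open>Mixing \<open>X\<close> with \<open>y0\<close> leads into \<open>Q\<close>, so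
    \<open>X\<close> has first label \<open>l\<close>. The vertex \<open>b\<close> missed by
    \<open>i\<close>, \<open>j\<close>, \<open>l\<close> then lies in \<open>B\<close> with second
    label \<open>k\<close>, and \<open>X\<close> and \<open>Q\<close> reproduce each other through
    \<open>y0\<close> and \<open>b\<close>.\<close>
  moreover have False if l: "Q \<subseteq> r -` {l}" for l
  proof -
    have Xl: "r x = l" if x: "x \<in> X" for x
    proof -
      have *: "x \<in> A" "y0 \<in> A" "r x \<noteq> r y0" "s x \<noteq> s y0"
        using x y0 by (auto simp: X_def Y_def)
      obtain b where b: "b \<in> B" "r b = r x \<and> s b = s y0 \<or> r b = r y0 \<and> s b = s x"
        by (rule common_neighbour[OF *])
      have lab: "r x \<noteq> i" "r x \<noteq> j" "s x = k" "r y0 = j" "s y0 \<noteq> k"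
        using x y0 by (simp_all add: X_def Y_def)
      have "\<not> (r b = r y0 \<and> s b = s x)"
        using no_N[OF b(1)] by (simp add: lab)
      then have lab_b: "r b = r x" "s b = s y0"
        using b(2) by blast+
      have "b \<in> Q"
        unfolding Q_def using lab by (simp add: lab_b b(1))
      then have "b \<in> r -` {l}"
        using l by (rule rev_subsetD)
      then show ?thesis
        by (simp add: lab_b)
    qed
    have "\<exists>b\<in>A \<union> B. r b \<noteq> i \<and> r b \<noteq> j \<and> r b \<noteq> l"
      using no3[of "r -` {i}" "r -` {j}" "r -` {l}"] by simp
    then obtain b where b: "b \<in> A \<union> B" "r b \<noteq> i" "r b \<noteq> j" "r b \<noteq> l"
      by (elim bexE conjE)
    have "b \<notin> Q"
    proof
      assume "b \<in> Q"
      then have "b \<in> r -` {l}"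
        using l by (rule rev_subsetD)
      with b(4) show False
        by simp
    qed
    have "b \<notin> A"
    proof
      assume "b \<in> A"
      then have "b \<in> X"
        using A_cover[of b] b(2,3) by (simp add: X_def)
      with b(4) show False
        by (simp add: Xl)
    qed
    then have bB: "b \<in> B"
      using b(1) by simp
    with \<open>b \<notin> Q\<close> b(2,3) have lab_b: "s b = k"
      by (simp add: Q_def)
    have "8 * card X \<le> card Q"
      by (rule growth[of y0]) (use cards y0 no_N in \<open>auto simp: X_def Y_def Q_def\<close>)
    moreover have "8 * card Q \<le> card X"
    proof (rule swap.growth[of b])
      fix y assume y: "y \<in> Q"
      then have "y \<in> r -` {l}"
        using l by blast
      then show "r b \<noteq> r y \<and> s b \<noteq> s y"
        using y b(2-) lab_b by (auto simp: Q_def)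
    next
      fix y a assume "y \<in> Q" "a \<in> A" "r a = r b \<and> s a = s y \<or> r a = r y \<and> s a = s b"
      then show "a \<in> X"
        using A_cover[of a] b lab_b by (auto simp: X_def Q_def)
    qed (use cards bB in \<open>auto simp: X_def Q_def\<close>)
    moreover have "0 < card X"
      using x0 by (auto simp: card_gt_0_iff)
    ultimately show False
      by linarith
  qed
  \<comment> \<open>The mirror image, with \<open>Y\<close> for \<open>X\<close> and
    \<open>x0\<close> for \<open>y0\<close>.\<close>
  moreover have False if l: "Q \<subseteq> s -` {l}" for l
  proof -
    have Yl: "s y = l" if y: "y \<in> Y" for y
    proof -
      have *: "x0 \<in> A" "y \<in> A" "r x0 \<noteq> r y" "s x0 \<noteq> s y"
        using x0 y by (auto simp: X_def Y_def)
      obtain b where b: "b \<in> B" "r b = r x0 \<and> s b = s y \<or> r b = r y \<and> s b = s x0"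
        by (rule common_neighbour[OF *])
      have lab: "r x0 \<noteq> i" "r x0 \<noteq> j" "s x0 = k" "r y = j" "s y \<noteq> k"
        using x0 y by (simp_all add: X_def Y_def)
      have "\<not> (r b = r y \<and> s b = s x0)"
        using no_N[OF b(1)] by (simp add: lab)
      then have lab_b: "r b = r x0" "s b = s y"
        using b(2) by blast+
      have "b \<in> Q"
        unfolding Q_def using lab by (simp add: lab_b b(1))
      then have "b \<in> s -` {l}"
        using l by (rule rev_subsetD)
      then show ?thesis
        by (simp add: lab_b)
    qed
    have "\<exists>b\<in>A \<union> B. r b \<noteq> i \<and> s b \<noteq> k \<and> s b \<noteq> l"
      using no3[of "r -` {i}" "s -` {k}" "s -` {l}"] by simp
    then obtain b where b: "b \<in> A \<union> B" "r b \<noteq> i" "s b \<noteq> k" "s b \<noteq> l"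
      by (elim bexE conjE)
    have "b \<notin> Q"
    proof
      assume "b \<in> Q"
      then have "b \<in> s -` {l}"
        using l by (rule rev_subsetD)
      with b(4) show False
        by simp
    qed
    have "b \<notin> A"
    proof
      assume "b \<in> A"
      then have "b \<in> Y"
        using A_cover[of b] b(2,3) by (simp add: Y_def)
      with b(4) show False
        by (simp add: Yl)
    qed
    then have bB: "b \<in> B"
      using b(1) by simp
    with \<open>b \<notin> Q\<close> b(2,3) have lab_b: "r b = j"
      by (simp add: Q_def)
    have "8 * card Y \<le> card Q"
      by (rule growth[of x0]) (use cards x0 no_N in \<open>auto simp: X_def Y_def Q_def\<close>)
    moreover have "8 * card Q \<le> card Y"
    proof (rule swap.growth[of b])
      fix y assume y: "y \<in> Q"
      then have "y \<in> s -` {l}"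
        using l by blast
      then show "r b \<noteq> r y \<and> s b \<noteq> s y"
        using y b(2-) lab_b by (auto simp: Q_def)
    next
      fix y a assume "y \<in> Q" "a \<in> A" "r a = r b \<and> s a = s y \<or> r a = r y \<and> s a = s b"
      then show "a \<in> Y"
        using A_cover[of a] b lab_b by (auto simp: Y_def Q_def)
    qed (use cards bB in \<open>auto simp: Y_def Q_def\<close>)
    moreover have "0 < card Y"
      using y0 by (auto simp: card_gt_0_iff)
    ultimately show False
      by linarith
  qed
  ultimately show False
    by blast
qed

lemma three_coverable_if_dominant_class:
  assumes "card (A - r -` {i}) < 8 * t" "card (B - r -` {i}) < 8 * t"
  shows "three_coverable (A \<union> B) r s"
proof (cases "card (B - r -` {i}) \<le> card (A - r -` {i})")
  case True
  then show ?thesis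
    using three_coverable_if_dominant_class_aux assms by blast
next
  case False
  interpret swap: expanding_labelling B A adj r s t
    by (rule swap_parts)
  show ?thesis
    using swap.three_coverable_if_dominant_class_aux[of i] False assms by (simp add: Un_commute)
qed

end

subsection \<open>Two red and two blue components\<close>

text \<open>Picture (iii): each half of \<open>A\<close> shares exactly one label with each half of
  \<open>B\<close>, alternately a first and a second label.\<close>

locale quartered_labelling = expanding_labelling +
  fixes i\<^sub>1 i\<^sub>2 j\<^sub>1 j\<^sub>2 :: 'c
  assumes distinct_labels: "i\<^sub>1 \<noteq> i\<^sub>2" "j\<^sub>1 \<noteq> j\<^sub>2"
    and exceptionalA: "card (A - (r -` {i\<^sub>1} \<inter> s -` {j\<^sub>2} \<union> r -` {i\<^sub>2} \<inter> s -` {j\<^sub>1})) < 8 * t"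
    and exceptionalB: "card (B - (r -` {i\<^sub>1} \<inter> s -` {j\<^sub>1} \<union> r -` {i\<^sub>2} \<inter> s -` {j\<^sub>2})) < 8 * t"
begin

text \<open>The common neighbours of a vertex of \<open>T\<^sub>1\<close> and a vertex of \<open>T\<^sub>2\<close> that differ in both labels are
  exceptional, whereas two vertices of \<open>T\<^sub>1\<close> may have common neighbours with labels \<open>i\<^sub>1\<close>, \<open>j\<^sub>1\<close>.\<close>

definition "EA = A - (r -` {i\<^sub>1} \<inter> s -` {j\<^sub>2} \<union> r -` {i\<^sub>2} \<inter> s -` {j\<^sub>1})"
definition "EB = B - (r -` {i\<^sub>1} \<inter> s -` {j\<^sub>1} \<union> r -` {i\<^sub>2} \<inter> s -` {j\<^sub>2})"
definition "T\<^sub>1 = {a \<in> EA. r a = i\<^sub>1 \<or> s a = j\<^sub>1}"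
definition "T\<^sub>2 = {a \<in> EA. r a = i\<^sub>2 \<or> s a = j\<^sub>2}"

lemma swap_indices: "quartered_labelling A B adj r s t i\<^sub>2 i\<^sub>1 j\<^sub>2 j\<^sub>1"
  by unfold_locales (use distinct_labels exceptionalA exceptionalB in \<open>simp_all add: Un_commute\<close>)

text \<open>The halves of \<open>B\<close> pair the labels the other way round, hence the exchange
  of \<open>j\<^sub>1\<close> and \<open>j\<^sub>2\<close>.\<close>

lemma swap_parts_quartered: "quartered_labelling B A adj r s t i\<^sub>1 i\<^sub>2 j\<^sub>2 j\<^sub>1"
proof -
  interpret swap: expanding_labelling B A adj r s t
    by (rule swap_parts)
  show ?thesis
    by unfold_locales (use distinct_labels exceptionalA exceptionalB in simp_all)
qed

lemma swap_labels_quartered: "quartered_labelling A B adj s r t j\<^sub>1 j\<^sub>2 i\<^sub>1 i\<^sub>2"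
proof -
  interpret swap: expanding_labelling A B adj s r t
    by (rule swap_labels)
  show ?thesis
    by unfold_locales
      (use distinct_labels exceptionalA exceptionalB in \<open>simp_all add: Un_commute Int_commute\<close>)
qed

text \<open>Each vertex of \<open>A\<close> has an unexceptional neighbour, with which it shares a
  label. A vertex in both \<open>T\<^sub>1\<close> and \<open>T\<^sub>2\<close> would carry the
  label pair of one of the halves.\<close>

lemma labelA:
  assumes "a \<in> A"
  shows "r a = i\<^sub>1 \<or> r a = i\<^sub>2 \<or> s a = j\<^sub>1 \<or> s a = j\<^sub>2"
    and "a \<in> EA \<Longrightarrow> a \<in> T\<^sub>1 \<or> a \<in> T\<^sub>2"
    and "\<not> (a \<in> T\<^sub>1 \<and> a \<in> T\<^sub>2)"
proof -
  show "r a = i\<^sub>1 \<or> r a = i\<^sub>2 \<or> s a = j\<^sub>1 \<or> s a = j\<^sub>2"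
    using neighbour_in[OF assms exceptionalB] by (metis IntE UnE vimage_singleton_eq)
  then show "a \<in> EA \<Longrightarrow> a \<in> T\<^sub>1 \<or> a \<in> T\<^sub>2"
    by (auto simp: T\<^sub>1_def T\<^sub>2_def)
  show "\<not> (a \<in> T\<^sub>1 \<and> a \<in> T\<^sub>2)"
    using distinct_labels by (auto simp: T\<^sub>1_def T\<^sub>2_def EA_def)
qed

lemma labelB:
  assumes "b \<in> B"
  shows "r b = i\<^sub>1 \<or> r b = i\<^sub>2 \<or> s b = j\<^sub>1 \<or> s b = j\<^sub>2"
proof -
  interpret swap: quartered_labelling B A adj r s t i\<^sub>1 i\<^sub>2 j\<^sub>2 j\<^sub>1
    by (rule swap_parts_quartered)
  show ?thesis
    using swap.labelA(1)[OF assms] by blast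
qed

lemma finite_exceptional [simp]: "finite EA" "finite EB" "finite T\<^sub>1" "finite T\<^sub>2"
  using finite_parts by (auto simp: EA_def EB_def T\<^sub>1_def T\<^sub>2_def)

lemma card_exceptional: "W \<subseteq> EA \<Longrightarrow> card W < 8 * t" "W \<subseteq> EB \<Longrightarrow> card W < 8 * t"
  using exceptionalA exceptionalB card_mono[of EA W] card_mono[of EB W]
  by (simp_all add: EA_def[symmetric] EB_def[symmetric])

text \<open>Here \<open>z\<^sub>0\<close> is the fixed partner for growth from \<open>A\<close>;
  \<open>b23\<close> and \<open>b13\<close> are found as partners for growth from \<open>B\<close>.
  Each round empties further label pairs, until no vertex can escape the classes
  \<open>i\<^sub>1\<close>, \<open>i\<^sub>2\<close>, \<open>i\<^sub>3\<close>.\<close>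

lemma three_coverable_if_T\<^sub>2_singular:
  assumes z\<^sub>0: "z\<^sub>0 \<in> T\<^sub>2" and T\<^sub>2: "T\<^sub>2 \<subseteq> r -` {i\<^sub>3} \<inter> s -` {j\<^sub>2}" and i\<^sub>3: "i\<^sub>3 \<noteq> i\<^sub>1" "i\<^sub>3 \<noteq> i\<^sub>2"
  shows "three_coverable (A \<union> B) r s"
proof (rule ccontr)
  assume neg: "\<not> three_coverable (A \<union> B) r s"
  interpret swap: expanding_labelling B A adj r s t
    by (rule swap_parts)
  have no3: "\<exists>v\<in>A \<union> B. v \<notin> X \<and> v \<notin> Y \<and> v \<notin> Z"
    if "X \<in> classes r s" "Y \<in> classes r s" "Z \<in> classes r s" for X Y Z
    using three_coverableI[OF that] neg by blast
  note neq = distinct_labels distinct_labels[symmetric] i\<^sub>3 i\<^sub>3[symmetric]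
  have z: "z\<^sub>0 \<in> A" "r z\<^sub>0 = i\<^sub>3" "s z\<^sub>0 = j\<^sub>2"
    using z\<^sub>0 T\<^sub>2 by (auto simp: T\<^sub>2_def EA_def)
  have A: "r a = i\<^sub>1 \<and> s a \<noteq> j\<^sub>2 \<or> r a \<noteq> i\<^sub>2 \<and> s a = j\<^sub>1 \<or> r a = i\<^sub>1 \<and> s a = j\<^sub>2 \<or> r a = i\<^sub>2 \<and> s a = j\<^sub>1
      \<or> r a = i\<^sub>3 \<and> s a = j\<^sub>2" if "a \<in> A" for a
    using labelA[OF that] T\<^sub>2 that by (auto simp: T\<^sub>1_def T\<^sub>2_def EA_def)
  have A2: "r a \<noteq> i\<^sub>2" if "a \<in> A" "s a \<noteq> j\<^sub>1" for a
    using A[OF that(1)] that neq by auto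
  have A3: "r a = i\<^sub>1 \<or> r a = i\<^sub>3" if "a \<in> A" "s a = j\<^sub>2" for a
    using A[OF that(1)] that neq by auto
  \<comment> \<open>From here on, \<open>bkl\<close> is a vertex of \<open>B\<close> with labels \<open>i\<^sub>k\<close> and \<open>j\<^sub>l\<close>. Each triple of classes that is
    not a cover yields a further vertex, until two label combinations reproduce each other.\<close>
  obtain b23 where b23: "b23 \<in> B" "r b23 = i\<^sub>2" "s b23 \<noteq> j\<^sub>1" "s b23 \<noteq> j\<^sub>2"
  proof -
    obtain v where v: "v \<in> A \<union> B" "r v \<noteq> i\<^sub>1" "s v \<noteq> j\<^sub>1" "s v \<noteq> j\<^sub>2"
      using no3[of "r -` {i\<^sub>1}" "s -` {j\<^sub>1}" "s -` {j\<^sub>2}"] by auto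
    then have "v \<notin> A"
      using A[of v] by auto
    then show ?thesis
      using that[of v] v labelB[of v] by auto
  qed
  define j\<^sub>3 where "j\<^sub>3 = s b23"
  have j\<^sub>3: "j\<^sub>3 \<noteq> j\<^sub>1" "j\<^sub>3 \<noteq> j\<^sub>2" "s b23 = j\<^sub>3"
    using b23 by (auto simp: j\<^sub>3_def)
  have pairA: "\<exists>b\<in>B. r b = r x \<and> s b = s y \<or> r b = r y \<and> s b = s x"
    if "x \<in> A" "y \<in> A" "r x \<noteq> r y" "s x \<noteq> s y" for x y
    using common_neighbour[OF that] by metis
  have pairB: "\<exists>a\<in>A. r a = r x \<and> s a = s y \<or> r a = r y \<and> s a = s x"
    if "x \<in> B" "y \<in> B" "r x \<noteq> r y" "s x \<noteq> s y" for x y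
    using swap.common_neighbour[OF that] by metis
  have noB_2: "r b = i\<^sub>1 \<or> r b = i\<^sub>2" if b: "b \<in> B" "s b = j\<^sub>2" for b
  proof (rule ccontr)
    assume *: "\<not> ?thesis"
    then obtain a where "a \<in> A" "r a = i\<^sub>2 \<and> s a = j\<^sub>2 \<or> r a = r b \<and> s a = j\<^sub>3"
      using pairB[of b23 b] b23 b j\<^sub>3 by auto
    then show False
      using A[of a] * neq j\<^sub>3 by auto
  qed
  have noB12: "\<not> (r b = i\<^sub>1 \<and> s b = j\<^sub>2)" if "b \<in> B" for b
  proof -
    \<comment> \<open>\<open>b23\<close> leads from \<open>W\<close> to \<open>X\<close> and
      \<open>z\<^sub>0\<close> back, since \<open>A2\<close> and \<open>labelB\<close> exclude the
      other mixed pairs. Growing by 8 in both directions leaves only empty sets.\<close>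
    define W where "W = {b \<in> B. r b = i\<^sub>1 \<and> s b = j\<^sub>2}"
    define X where "X = {a \<in> A. r a = i\<^sub>1 \<and> s a = j\<^sub>3}"
    have "W \<subseteq> EB" "X \<subseteq> EA"
      using neq j\<^sub>3 by (auto simp: W_def X_def EA_def EB_def)
    note * = card_exceptional(2)[OF this(1)] card_exceptional(1)[OF this(2)]
    have "8 * card W \<le> card X"
      by (rule swap.growth[of b23])
        (use * b23 j\<^sub>3 A2 neq in \<open>auto simp: W_def X_def\<close>)
    moreover have "8 * card X \<le> card W"
    proof (rule growth[of z\<^sub>0])
      fix y b assume "y \<in> X" "b \<in> B" "r b = r z\<^sub>0 \<and> s b = s y \<or> r b = r y \<and> s b = s z\<^sub>0"
      then show "b \<in> W"
        using labelB[of b] j\<^sub>3 neq z by (auto simp: W_def X_def)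
    qed (use * z j\<^sub>3 neq in \<open>auto simp: W_def X_def\<close>)
    ultimately have "card W = 0"
      by linarith
    then show ?thesis
      using that finite_parts by (auto simp: W_def)
  qed
  have noA1: "s a = j\<^sub>1 \<or> s a = j\<^sub>2" if a: "a \<in> A" "r a = i\<^sub>1" for a
  proof (rule ccontr)
    assume *: "\<not> ?thesis"
    then obtain b where "b \<in> B" "r b = i\<^sub>1 \<and> s b = j\<^sub>2 \<or> r b = i\<^sub>3 \<and> s b = s a"
      using pairA[of a z\<^sub>0] a z neq by auto
    then show False
      using noB12[of b] labelB[of b] * neq by auto
  qed
  obtain b13 where b13: "b13 \<in> B" "r b13 = i\<^sub>1" "s b13 = j\<^sub>3"
  proof -
    obtain v where v: "v \<in> A \<union> B" "r v \<noteq> i\<^sub>2" "s v \<noteq> j\<^sub>1" "s v \<noteq> j\<^sub>2"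
      using no3[of "r -` {i\<^sub>2}" "s -` {j\<^sub>1}" "s -` {j\<^sub>2}"] by auto
    then have "v \<notin> A"
      using A[of v] noA1[of v] by auto
    then have vB: "v \<in> B" "r v = i\<^sub>1"
      using v labelB[of v] by auto
    have "s v = j\<^sub>3"
    proof (rule ccontr)
      assume "s v \<noteq> j\<^sub>3"
      then obtain a where "a \<in> A" "r a = i\<^sub>2 \<and> s a = s v \<or> r a = i\<^sub>1 \<and> s a = j\<^sub>3"
        using pairB[of b23 v] b23 vB j\<^sub>3 neq by auto
      then show False
        using A2[of a] noA1[of a] v j\<^sub>3 by auto
    qed
    then show ?thesis
      using that vB by blast
  qed
  have no_corner: "\<not> (r a = i\<^sub>1 \<and> s a = j\<^sub>1)" "\<not> (r b = i\<^sub>3 \<and> s b = j\<^sub>1)"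
    if "a \<in> A" "b \<in> B" for a b
  proof -
    \<comment> \<open>The same loop through \<open>b13\<close> and \<open>z\<^sub>0\<close>;
      \<open>noB12\<close> now excludes one of the mixed pairs.\<close>
    define X where "X = {a \<in> A. r a = i\<^sub>1 \<and> s a = j\<^sub>1}"
    define W where "W = {b \<in> B. r b = i\<^sub>3 \<and> s b = j\<^sub>1}"
    have "W \<subseteq> EB" "X \<subseteq> EA"
      using neq j\<^sub>3 by (auto simp: W_def X_def EA_def EB_def)
    note * = card_exceptional(2)[OF this(1)] card_exceptional(1)[OF this(2)]
    have "8 * card W \<le> card X"
    proof (rule swap.growth[of b13])
      fix y a assume "y \<in> W" "a \<in> A" "r a = r b13 \<and> s a = s y \<or> r a = r y \<and> s a = s b13"
      then show "a \<in> X"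
        using labelA(1)[of a] b13 j\<^sub>3 neq by (auto simp: W_def X_def)
    qed (use * b13 j\<^sub>3 neq in \<open>auto simp: W_def X_def\<close>)
    moreover have "8 * card X \<le> card W"
    proof (rule growth[of z\<^sub>0])
      fix y b assume "y \<in> X" "b \<in> B" "r b = r z\<^sub>0 \<and> s b = s y \<or> r b = r y \<and> s b = s z\<^sub>0"
      then show "b \<in> W"
        using noB12[of b] z by (auto simp: W_def X_def)
    qed (use * z neq in \<open>auto simp: W_def X_def\<close>)
    ultimately have "card W = 0" "card X = 0"
      by linarith+
    then show "\<not> (r a = i\<^sub>1 \<and> s a = j\<^sub>1)" "\<not> (r b = i\<^sub>3 \<and> s b = j\<^sub>1)"
      using that finite_parts by (auto simp: W_def X_def)
  qed
  \<comment> \<open>The second label of \<open>v\<close> turns out to be \<open>j\<^sub>1\<close>;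
    mixing \<open>v\<close> with \<open>z\<^sub>0\<close> or \<open>b13\<close> then gives only
    excluded pairs.\<close>
  obtain v where v: "v \<in> A \<union> B" "r v \<noteq> i\<^sub>1" "r v \<noteq> i\<^sub>2" "r v \<noteq> i\<^sub>3"
    using no3[of "r -` {i\<^sub>1}" "r -` {i\<^sub>2}" "r -` {i\<^sub>3}"] by auto
  show False
  proof (cases "v \<in> A")
    case True
    then have "s v = j\<^sub>1"
      using A[of v] v by auto
    then obtain b where "b \<in> B" "r b = r v \<and> s b = j\<^sub>2 \<or> r b = i\<^sub>3 \<and> s b = j\<^sub>1"
      using pairA[of v z\<^sub>0] True z v neq by auto
    then show False
      using noB_2[of b] no_corner(2)[of v b] v True by auto
  next
    case False
    then have vB: "v \<in> B"
      using v by auto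
    then have "s v = j\<^sub>1"
      using labelB[of v] noB_2[of v] v by auto
    then obtain a where "a \<in> A" "r a = r v \<and> s a = j\<^sub>3 \<or> r a = i\<^sub>1 \<and> s a = j\<^sub>1"
      using pairB[of v b13] vB b13 v j\<^sub>3 by auto
    then show False
      using labelA(1)[of a] no_corner(1)[of a v] vB v j\<^sub>3 by auto
  qed
qed

text \<open>Each vertex of \<open>T\<^sub>2\<close> differs in both labels from at most a quarter of
  \<open>T\<^sub>1\<close>, so any two of them share a partner in \<open>T\<^sub>1\<close>. The
  partner determines their labels, so all of \<open>T\<^sub>2\<close> has one label pair.\<close>

lemma three_coverable_if_more_exceptional_aux:
  assumes le: "card EB \<le> card EA" "card T\<^sub>2 \<le> card T\<^sub>1"
  shows "three_coverable (A \<union> B) r s"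
proof (cases "T\<^sub>2 = {}")
  case True
  have "r a = i\<^sub>1 \<or> s a = j\<^sub>1" if "a \<in> A" for a
    using labelA(2)[OF that] that True by (cases "a \<in> EA") (auto simp: T\<^sub>1_def EA_def)
  then have "A \<subseteq> r -` {i\<^sub>1} \<union> s -` {j\<^sub>1}"
    by blast
  then show ?thesis
    by (intro three_coverable_if_two_cover_part) auto
next
  case False
  then obtain z\<^sub>0 where z\<^sub>0: "z\<^sub>0 \<in> T\<^sub>2"
    by blast
  define D where "D = (\<lambda>z. {x \<in> T\<^sub>1. r z \<noteq> r x \<and> s z \<noteq> s x})"
  have "card EA \<le> card (T\<^sub>1 \<union> T\<^sub>2)"
    using labelA(2) by (intro card_mono) (auto simp: EA_def)
  also have "\<dots> \<le> card T\<^sub>1 + card T\<^sub>2"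
    by (rule card_Un_le)
  finally have EA_le: "card EA \<le> 2 * card T\<^sub>1"
    using le(2) by simp
  have few: "8 * card (D z) \<le> 2 * card T\<^sub>1" if z: "z \<in> T\<^sub>2" for z
  proof -
    have "8 * card (D z) \<le> card EB"
    proof (rule growth[of z])
      show "card EB < 8 * t"
        by (rule card_exceptional(2)) simp
      fix y b assume *: "y \<in> D z" "b \<in> B" "r b = r z \<and> s b = s y \<or> r b = r y \<and> s b = s z"
      then show "b \<in> EB"
        using z distinct_labels by (auto simp: D_def T\<^sub>1_def T\<^sub>2_def EA_def EB_def)
    qed (use z in \<open>auto simp: D_def T\<^sub>1_def T\<^sub>2_def EA_def EB_def\<close>)
    then show ?thesis
      using le(1) EA_le by linarith
  qed
  have "0 < card T\<^sub>2"
    using z\<^sub>0 by (auto simp: card_gt_0_iff)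
  have common: "\<exists>x\<in>T\<^sub>1. (r z = r x \<or> s z = s x) \<and> (r z' = r x \<or> s z' = s x)"
    if z: "z \<in> T\<^sub>2" "z' \<in> T\<^sub>2" for z z'
  proof (rule ccontr)
    assume "\<not> ?thesis"
    then have "card T\<^sub>1 \<le> card (D z \<union> D z')"
      by (intro card_mono) (auto simp: D_def)
    also have "\<dots> \<le> card (D z) + card (D z')"
      by (rule card_Un_le)
    finally show False
      using few[OF z(1)] few[OF z(2)] le(2) \<open>0 < card T\<^sub>2\<close> by linarith
  qed
  \<comment> \<open>The shared label is none of the special ones of its kind, or one of the two
    vertices would be unexceptional. So the other labels place them in \<open>T\<^sub>2\<close> and
    \<open>T\<^sub>1\<close>.\<close>
  have shared: "s z = j\<^sub>2 \<and> s x = j\<^sub>1 \<and> r z = r x \<and> r z \<noteq> i\<^sub>1 \<and> r z \<noteq> i\<^sub>2 \<or>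
      r z = i\<^sub>2 \<and> r x = i\<^sub>1 \<and> s z = s x \<and> s z \<noteq> j\<^sub>1 \<and> s z \<noteq> j\<^sub>2"
    if "z \<in> T\<^sub>2" "x \<in> T\<^sub>1" "r z = r x \<or> s z = s x" for x z
    using that distinct_labels by (auto simp: T\<^sub>1_def T\<^sub>2_def EA_def)
  obtain x\<^sub>0 where "x\<^sub>0 \<in> T\<^sub>1" "r z\<^sub>0 = r x\<^sub>0 \<or> s z\<^sub>0 = s x\<^sub>0"
    using common[OF z\<^sub>0 z\<^sub>0] by blast
  then consider
    (row) "s z\<^sub>0 = j\<^sub>2" "r z\<^sub>0 \<noteq> i\<^sub>1" "r z\<^sub>0 \<noteq> i\<^sub>2" | (column) "r z\<^sub>0 = i\<^sub>2" "s z\<^sub>0 \<noteq> j\<^sub>1" "s z\<^sub>0 \<noteq> j\<^sub>2"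
    using shared[OF z\<^sub>0] by blast
  then show ?thesis
  proof cases
    case row
    have "r z = r z\<^sub>0 \<and> s z = j\<^sub>2" if z: "z \<in> T\<^sub>2" for z
    proof -
      obtain x where "x \<in> T\<^sub>1" "r z = r x \<or> s z = s x" "r z\<^sub>0 = r x \<or> s z\<^sub>0 = s x"
        using common[OF z z\<^sub>0] by blast
      then show ?thesis
        using shared[OF z, of x] shared[OF z\<^sub>0, of x] row by auto
    qed
    then show ?thesis
      by (intro three_coverable_if_T\<^sub>2_singular[OF z\<^sub>0]) (use row in auto)
  next
    case column
    have "s z = s z\<^sub>0 \<and> r z = i\<^sub>2" if z: "z \<in> T\<^sub>2" for z
    proof -
      obtain x where "x \<in> T\<^sub>1" "r z = r x \<or> s z = s x" "r z\<^sub>0 = r x \<or> s z\<^sub>0 = s x"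
        using common[OF z z\<^sub>0] by blast
      then show ?thesis
        using shared[OF z, of x] shared[OF z\<^sub>0, of x] column by auto
    qed
    note * = this
    interpret swap: quartered_labelling A B adj s r t j\<^sub>1 j\<^sub>2 i\<^sub>1 i\<^sub>2
      by (rule swap_labels_quartered)
    have EA: "swap.EA = EA"
      unfolding swap.EA_def EA_def by auto
    have T\<^sub>2: "swap.T\<^sub>2 = T\<^sub>2"
      unfolding swap.T\<^sub>2_def T\<^sub>2_def EA by auto
    have "three_coverable (A \<union> B) s r"
    proof (rule swap.three_coverable_if_T\<^sub>2_singular)
      show "z\<^sub>0 \<in> swap.T\<^sub>2" "s z\<^sub>0 \<noteq> j\<^sub>1" "s z\<^sub>0 \<noteq> j\<^sub>2"
        using z\<^sub>0 T\<^sub>2 column by simp_all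
      show "swap.T\<^sub>2 \<subseteq> s -` {s z\<^sub>0} \<inter> r -` {i\<^sub>2}"
        unfolding T\<^sub>2
      proof
        fix z assume "z \<in> T\<^sub>2"
        from *[OF this] show "z \<in> s -` {s z\<^sub>0} \<inter> r -` {i\<^sub>2}"
          by simp
      qed
    qed
    then show ?thesis
      by (simp add: three_coverable_def classes_commute)
  qed
qed

lemma three_coverable_if_more_exceptional:
  assumes le: "card EB \<le> card EA"
  shows "three_coverable (A \<union> B) r s"
proof (cases "card T\<^sub>2 \<le> card T\<^sub>1")
  case True
  then show ?thesis
    using three_coverable_if_more_exceptional_aux le by blast
next
  case False
  interpret swap: quartered_labelling A B adj r s t i\<^sub>2 i\<^sub>1 j\<^sub>2 j\<^sub>1
    by (rule swap_indices)
  have E: "swap.EA = EA" "swap.EB = EB"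
    unfolding swap.EA_def EA_def swap.EB_def EB_def by auto
  have "swap.T\<^sub>2 = T\<^sub>1" "swap.T\<^sub>1 = T\<^sub>2"
    unfolding swap.T\<^sub>2_def T\<^sub>2_def swap.T\<^sub>1_def T\<^sub>1_def E by auto
  then show ?thesis
    using swap.three_coverable_if_more_exceptional_aux E le False by simp
qed

lemma three_coverable_quartered: "three_coverable (A \<union> B) r s"
proof (cases "card EB \<le> card EA")
  case True
  then show ?thesis
    by (rule three_coverable_if_more_exceptional)
next
  case False
  interpret swap: quartered_labelling B A adj r s t i\<^sub>1 i\<^sub>2 j\<^sub>2 j\<^sub>1
    by (rule swap_parts_quartered)
  have "swap.EA = EB" "swap.EB = EA"
    unfolding swap.EA_def EA_def swap.EB_def EB_def by auto
  then show ?thesis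
    using swap.three_coverable_if_more_exceptional False by (simp add: Un_commute)
qed

end

subsection \<open>Reduction to the global pictures\<close>

text \<open>Adding fibres one at a time raises the size by less than \<open>t\<close>, so it cannot
  jump over the window from \<open>t\<close> to \<open>2 * t\<close>.\<close>

lemma union_of_small_fibres:
  assumes "finite X" "\<And>j. card (X \<inter> f -` {j}) < t" "t \<le> card X"
  obtains P where "t \<le> card (X \<inter> f -` P)" "card (X \<inter> f -` P) < 2 * t"
proof -
  have "\<exists>P. t \<le> card (X \<inter> f -` P) \<and> card (X \<inter> f -` P) < 2 * t"
    if "finite P" "t \<le> card (X \<inter> f -` P)" for P
    using that
  proof (induction P rule: finite_induct)
    case empty
    then show ?case
      using assms(2) by simp
  next
    case (insert j P)
    show ?case
    proof (cases "t \<le> card (X \<inter> f -` P)")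
      case True
      then show ?thesis
        using insert.IH by blast
    next
      case False
      have "X \<inter> f -` insert j P = X \<inter> f -` P \<union> X \<inter> f -` {j}"
        by blast
      then have "card (X \<inter> f -` insert j P) \<le> card (X \<inter> f -` P) + card (X \<inter> f -` {j})"
        by (simp add: card_Un_le)
      then show ?thesis
        using False assms(2)[of j] insert.prems by (intro exI[of _ "insert j P"]) linarith
    qed
  qed
  from this[of "f ` X"] show ?thesis
    using that assms(1,3) by (metis Int_absorb2 finite_imageI image_subset_iff_subset_vimage order_refl)
qed

context expanding_labelling
begin

lemma card_less_if_no_edge:
  assumes "X \<subseteq> A" "Y \<subseteq> B" "\<And>x y. x \<in> X \<Longrightarrow> y \<in> Y \<Longrightarrow> \<not> adj x y"
  shows "t \<le> card X \<Longrightarrow> card Y < t" "t \<le> card Y \<Longrightarrow> card X < t"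
  using cross[OF assms(1,2)] assms(3) by (meson not_le)+

text \<open>No edge crosses a cut along second labels. Were all fibres on \<open>X\<close> small,
  some cut would leave \<open>t\<close> vertices of \<open>X\<close> on both sides, hence fewer than
  \<open>2 * t\<close> vertices in \<open>Y\<close>.\<close>

lemma connected_up_to_small:
  assumes X: "X \<subseteq> A" "3 * t \<le> card X" and Y: "Y \<subseteq> B" "3 * t \<le> card Y"
    and s_eq: "\<And>x y. x \<in> X \<Longrightarrow> y \<in> Y \<Longrightarrow> adj x y \<Longrightarrow> s x = s y"
  obtains j where "card (X - s -` {j}) < t" "card (Y - s -` {j}) < t"
proof -
  have fin: "finite X" "finite Y"
    using X(1) Y(1) finite_parts finite_subset by blast+
  have split: "card Z = card (Z \<inter> s -` P) + card (Z - s -` P)" if "finite Z" for Z P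
    by (metis Diff_disjoint Int_Diff_Un Int_Diff card_Un_disjoint finite_Diff finite_Int
        inf_commute inf_bot_right that)
  have sub: "X \<inter> s -` P \<subseteq> A" "X - s -` P \<subseteq> A" "Y \<inter> s -` P \<subseteq> B" "Y - s -` P \<subseteq> B" for P
    using X(1) Y(1) by blast+
  have less: "card (Y - s -` P) < t" if "t \<le> card (X \<inter> s -` P)" for P
    using that s_eq by (intro card_less_if_no_edge(1)[OF sub(1,4)]) auto
  have less_X: "card (X - s -` P) < t" if "t \<le> card (Y \<inter> s -` P)" for P
    using that s_eq by (intro card_less_if_no_edge(2)[OF sub(2,3)]) auto
  have less_Y: "card (Y \<inter> s -` P) < t" if "t \<le> card (X - s -` P)" for P
    using that s_eq by (intro card_less_if_no_edge(1)[OF sub(2,3)]) auto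
  have "\<exists>j. t \<le> card (X \<inter> s -` {j})"
  proof (rule ccontr)
    assume "\<not> ?thesis"
    then have "\<And>j. card (X \<inter> s -` {j}) < t"
      by (simp add: not_le)
    moreover have "t \<le> card X"
      using X(2) by simp
    ultimately obtain P where P: "t \<le> card (X \<inter> s -` P)" "card (X \<inter> s -` P) < 2 * t"
      using union_of_small_fibres[OF fin(1)] by blast
    have "t \<le> card (X - s -` P)"
      using P(2) X(2) split[OF fin(1), of P] by linarith
    then have "card (Y \<inter> s -` P) < t"
      by (rule less_Y)
    moreover have "card (Y - s -` P) < t"
      using P(1) by (rule less)
    ultimately show False
      using Y(2) split[OF fin(2), of P] by linarith
  qed
  then obtain j where j: "t \<le> card (X \<inter> s -` {j})"
    by blast
  then have "card (Y - s -` {j}) < t"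
    by (rule less)
  moreover from this have "t \<le> card (Y \<inter> s -` {j})"
    using Y(2) split[OF fin(2), of "{j}"] by linarith
  then have "card (X - s -` {j}) < t"
    by (rule less_X)
  ultimately show ?thesis
    using that by blast
qed

text \<open>Picture (ii): all but fewer than \<open>5 * t\<close> vertices of \<open>A\<close> carry
  both \<open>i\<close> and some \<open>j\<close>. Every vertex of \<open>B\<close> has a neighbour
  among them, so two classes cover \<open>B\<close>.\<close>

lemma three_coverable_if_class_almost_contains_part:
  assumes AC: "3 * t \<le> card (A \<inter> r -` {i})" "card (A - r -` {i}) < 4 * t"
    and BC: "4 * t \<le> card (B - r -` {i})"
  shows "three_coverable (A \<union> B) r s"
proof -
  interpret swap: expanding_labelling B A adj r s t
    by (rule swap_parts)
  have "s x = s y" if "x \<in> A \<inter> r -` {i}" "y \<in> B - r -` {i}" "adj x y" for x y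
    using share[of x y] that by auto
  moreover have "A \<inter> r -` {i} \<subseteq> A" "B - r -` {i} \<subseteq> B" "3 * t \<le> card (B - r -` {i})"
    using BC by auto
  ultimately obtain j where j: "card (A \<inter> r -` {i} - s -` {j}) < t"
    using connected_up_to_small[of "A \<inter> r -` {i}" "B - r -` {i}"] AC(1) by metis
  have "A - r -` {i} \<inter> s -` {j} = (A - r -` {i}) \<union> (A \<inter> r -` {i} - s -` {j})"
    by blast
  then have "card (A - r -` {i} \<inter> s -` {j}) \<le> card (A - r -` {i}) + card (A \<inter> r -` {i} - s -` {j})"
    by (simp add: card_Un_le)
  then have *: "card (A - r -` {i} \<inter> s -` {j}) < 8 * t"
    using AC(2) j by linarith
  have "b \<in> r -` {i} \<union> s -` {j}" if "b \<in> B" for b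
    by (rule swap.neighbour_in[OF that *]) auto
  then have "three_coverable (B \<union> A) r s"
    by (intro swap.three_coverable_if_two_cover_part[of "r -` {i}" "s -` {j}"]) auto
  then show ?thesis
    by (simp add: Un_commute)
qed

text \<open>Edges between inside and outside of class \<open>i\<close> keep the second label, mostly
  \<open>j\<close> or \<open>j'\<close> according to direction. If these agree, one second label
  dominates, picture (i). Otherwise edges between the outer parts keep the first label, which yields
  \<open>i'\<close> and picture (iii).\<close>

lemma three_coverable_if_class_splits_parts:
  assumes A: "3 * t \<le> card (A \<inter> r -` {i})" "4 * t \<le> card (A - r -` {i})"
    and B: "3 * t \<le> card (B \<inter> r -` {i})" "4 * t \<le> card (B - r -` {i})"
  shows "three_coverable (A \<union> B) r s"
proof -
  interpret swap: expanding_labelling A B adj s r t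
    by (rule swap_labels)
  have in_out: "s x = s y" if "x \<in> A \<inter> r -` {i}" "y \<in> B - r -` {i}" "adj x y" for x y
    using share[of x y] that by auto
  have out_in: "s x = s y" if "x \<in> A - r -` {i}" "y \<in> B \<inter> r -` {i}" "adj x y" for x y
    using share[of x y] that by auto
  have "3 * t \<le> card (A - r -` {i})" "3 * t \<le> card (B - r -` {i})"
    using A(2) B(2) by simp_all
  then obtain j j' where
    j: "card (A - r -` {i} - s -` {j}) < t" "card (B \<inter> r -` {i} - s -` {j}) < t" and
    j': "card (A \<inter> r -` {i} - s -` {j'}) < t" "card (B - r -` {i} - s -` {j'}) < t"
    using connected_up_to_small[OF Int_lower1 A(1) Diff_subset _ in_out]
      connected_up_to_small[OF Diff_subset _ Int_lower1 B(1) out_in] by metis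
  show ?thesis
  proof (cases "j = j'")
    case True
    have "A - s -` {j} = (A - r -` {i} - s -` {j}) \<union> (A \<inter> r -` {i} - s -` {j})"
      "B - s -` {j} = (B - r -` {i} - s -` {j}) \<union> (B \<inter> r -` {i} - s -` {j})"
      by blast+
    then have "card (A - s -` {j}) \<le> card (A - r -` {i} - s -` {j}) + card (A \<inter> r -` {i} - s -` {j})"
      "card (B - s -` {j}) \<le> card (B - r -` {i} - s -` {j}) + card (B \<inter> r -` {i} - s -` {j})"
      by (simp_all add: card_Un_le)
    then have "three_coverable (A \<union> B) s r"
      using j j' True by (intro swap.three_coverable_if_dominant_class[of j]) simp_all
    then show ?thesis
      by (simp add: three_coverable_def classes_commute)
  next
    case False
    define X where "X = (A - r -` {i}) \<inter> s -` {j}"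
    define Y where "Y = (B - r -` {i}) \<inter> s -` {j'}"
    have sub: "X \<subseteq> A" "Y \<subseteq> B" and fin: "finite X" "finite Y"
      using finite_parts by (auto simp: X_def Y_def)
    have "A - r -` {i} = X \<union> (A - r -` {i} - s -` {j})" "B - r -` {i} = Y \<union> (B - r -` {i} - s -` {j'})"
      by (auto simp: X_def Y_def)
    then have "card (A - r -` {i}) \<le> card X + card (A - r -` {i} - s -` {j})"
      "card (B - r -` {i}) \<le> card Y + card (B - r -` {i} - s -` {j'})"
      by (metis card_Un_le)+
    then have big: "3 * t \<le> card X" "3 * t \<le> card Y"
      using A(2) B(2) j(1) j'(2) by linarith+
    have "r x = r y" if "x \<in> X" "y \<in> Y" "adj x y" for x y
      using share[of x y] that False by (auto simp: X_def Y_def)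
    then obtain i' where i': "card (X - r -` {i'}) < t" "card (Y - r -` {i'}) < t"
      using swap.connected_up_to_small[OF sub(1) big(1) sub(2) big(2)] by metis
    have "i' \<noteq> i"
    proof
      assume "i' = i"
      then have "X - r -` {i'} = X"
        by (auto simp: X_def)
      then show False
        using i'(1) big(1) by simp
    qed
    have "card (A - (r -` {i} \<inter> s -` {j'} \<union> r -` {i'} \<inter> s -` {j}))
        \<le> card ((A \<inter> r -` {i} - s -` {j'}) \<union> ((A - r -` {i} - s -` {j}) \<union> (X - r -` {i'})))"
      by (intro card_mono) (use finite_parts in \<open>auto simp: X_def\<close>)
    also have "\<dots> \<le> card (A \<inter> r -` {i} - s -` {j'}) + (card (A - r -` {i} - s -` {j}) + card (X - r -` {i'}))"
      by (meson add_left_mono card_Un_le order_trans)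
    finally have exA: "card (A - (r -` {i} \<inter> s -` {j'} \<union> r -` {i'} \<inter> s -` {j})) < 8 * t"
      using j j' i' by linarith
    have "card (B - (r -` {i} \<inter> s -` {j} \<union> r -` {i'} \<inter> s -` {j'}))
        \<le> card ((B \<inter> r -` {i} - s -` {j}) \<union> ((B - r -` {i} - s -` {j'}) \<union> (Y - r -` {i'})))"
      by (intro card_mono) (use finite_parts in \<open>auto simp: Y_def\<close>)
    also have "\<dots> \<le> card (B \<inter> r -` {i} - s -` {j}) + (card (B - r -` {i} - s -` {j'}) + card (Y - r -` {i'}))"
      by (meson add_left_mono card_Un_le order_trans)
    finally have exB: "card (B - (r -` {i} \<inter> s -` {j} \<union> r -` {i'} \<inter> s -` {j'})) < 8 * t"
      using j j' i' by linarith
    interpret quartered_labelling A B adj r s t i i' j j'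
      by unfold_locales (use False \<open>i' \<noteq> i\<close> exA exB in auto)
    show ?thesis
      by (rule three_coverable_quartered)
  qed
qed

lemma three_coverable_if_big_class:
  assumes "3 * t \<le> card (A \<inter> r -` {i})" "3 * t \<le> card (B \<inter> r -` {i})"
  shows "three_coverable (A \<union> B) r s"
proof -
  interpret swap: expanding_labelling B A adj r s t
    by (rule swap_parts)
  \<comment> \<open>The bound \<open>4 * t\<close> leaves \<open>3 * t\<close> vertices after
    dropping fewer than \<open>t\<close> strays, as \<open>connected_up_to_small\<close>
    demands.\<close>
  consider "card (A - r -` {i}) < 4 * t" "card (B - r -` {i}) < 4 * t"
    | "card (A - r -` {i}) < 4 * t" "4 * t \<le> card (B - r -` {i})"
    | "card (B - r -` {i}) < 4 * t" "4 * t \<le> card (A - r -` {i})"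
    | "4 * t \<le> card (A - r -` {i})" "4 * t \<le> card (B - r -` {i})"
    by linarith
  then show ?thesis
  proof cases
    case 1
    then show ?thesis
      by (intro three_coverable_if_dominant_class[of i]) linarith+
  next
    case 2
    then show ?thesis
      using three_coverable_if_class_almost_contains_part assms(1) by blast
  next
    case 3
    then have "three_coverable (B \<union> A) r s"
      using swap.three_coverable_if_class_almost_contains_part assms(2) by blast
    then show ?thesis
      by (simp add: Un_commute)
  next
    case 4
    then show ?thesis
      using three_coverable_if_class_splits_parts assms by blast
  qed
qed

text \<open>If class \<open>i\<close> is large in \<open>B\<close> only, then the edges from it to
  the at least \<open>5 * t\<close> vertices of \<open>A\<close> outside make some second label
  large on both sides.\<close>

lemma three_coverable_if_big_in_part:
  assumes "4 * t \<le> card (B \<inter> r -` {i})"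
  shows "three_coverable (A \<union> B) r s"
proof (cases "3 * t \<le> card (A \<inter> r -` {i})")
  case True
  then show ?thesis
    using assms by (intro three_coverable_if_big_class[of i]) linarith+
next
  case False
  interpret swap_parts: expanding_labelling B A adj r s t
    by (rule swap_parts)
  interpret swap: expanding_labelling A B adj s r t
    by (rule swap_labels)
  obtain b where "b \<in> B"
    using t_less(2) by fastforce
  then have "8 * t \<le> card {a \<in> A. adj b a}"
    by (rule swap_parts.degree_ge)
  also have "\<dots> \<le> card A"
    using finite_parts by (intro card_mono) auto
  finally have "8 * t \<le> card A" .
  moreover have "card A \<le> card (A - r -` {i}) + card (A \<inter> r -` {i})"
    by (metis Un_Diff_Int card_Un_le)
  ultimately have A: "5 * t \<le> card (A - r -` {i})"
    using False by linarith
  have "s x = s y" if "x \<in> A - r -` {i}" "y \<in> B \<inter> r -` {i}" "adj x y" for x y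
    using share[of x y] that by auto
  moreover have "3 * t \<le> card (A - r -` {i})" "3 * t \<le> card (B \<inter> r -` {i})"
    using A assms by linarith+
  ultimately obtain j where
    j: "card (A - r -` {i} - s -` {j}) < t" "card (B \<inter> r -` {i} - s -` {j}) < t"
    using connected_up_to_small[OF Diff_subset _ Int_lower1] by metis
  have "card (A - r -` {i}) \<le> card (A \<inter> s -` {j}) + card (A - r -` {i} - s -` {j})"
    "card (B \<inter> r -` {i}) \<le> card (B \<inter> s -` {j}) + card (B \<inter> r -` {i} - s -` {j})"
    by (rule order_trans[OF card_mono card_Un_le]; use finite_parts in auto)+
  then have "three_coverable (A \<union> B) s r"
    using j A assms by (intro swap.three_coverable_if_big_class[of j]) linarith+
  then show ?thesis
    by (simp add: three_coverable_def classes_commute)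
qed

theorem three_coverable: "three_coverable (A \<union> B) r s"
proof -
  interpret swap: expanding_labelling A B adj s r t
    by (rule swap_labels)
  obtain a where a: "a \<in> A"
    using t_less(1) by fastforce
  then have "8 * t \<le> card {b \<in> B. adj a b}"
    by (rule degree_ge)
  also have "\<dots> \<le> card ((B \<inter> r -` {r a}) \<union> (B \<inter> s -` {s a}))"
    using finite_parts by (intro card_mono) (auto dest: share[OF a])
  also have "\<dots> \<le> card (B \<inter> r -` {r a}) + card (B \<inter> s -` {s a})"
    by (rule card_Un_le)
  finally consider "4 * t \<le> card (B \<inter> r -` {r a})" | "4 * t \<le> card (B \<inter> s -` {s a})"
    by linarith
  then show ?thesis
  proof cases
    case 1
    then show ?thesis
      by (rule three_coverable_if_big_in_part)
  next
    case 2
    then show ?thesis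
      using swap.three_coverable_if_big_in_part by (simp add: three_coverable_def classes_commute)
  qed
qed

end

subsection \<open>Expansion of the random bipartite graph\<close>

text \<open>Independence of disjoint coordinate blocks: the product over \<open>I\<close> is the
  image of a pair of independent products over \<open>J\<close> and \<open>I - J\<close>.\<close>

lemma nn_integral_Pi_pmf_mult:
  fixes u v :: "('i \<Rightarrow> 'b) \<Rightarrow> ennreal"
  assumes "finite I" "J \<subseteq> I"
    and u: "\<And>f f'. (\<And>e. e \<in> J \<Longrightarrow> f e = f' e) \<Longrightarrow> u f = u f'"
    and v: "\<And>f f'. (\<And>e. e \<notin> J \<Longrightarrow> f e = f' e) \<Longrightarrow> v f = v f'"
  shows "(\<integral>\<^sup>+f. u f * v f \<partial>Pi_pmf I d p) = (\<integral>\<^sup>+f. u f \<partial>Pi_pmf I d p) * (\<integral>\<^sup>+f. v f \<partial>Pi_pmf I d p)"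
proof -
  define P Q where "P = Pi_pmf J d p" and "Q = Pi_pmf (I - J) d p"
  define h :: "('i \<Rightarrow> 'b) \<times> ('i \<Rightarrow> 'b) \<Rightarrow> 'i \<Rightarrow> 'b"
    where "h = (\<lambda>(f, g) x. if x \<in> J then f x else g x)"
  have "Pi_pmf (J \<union> (I - J)) d p = map_pmf h (pair_pmf P Q)"
    unfolding P_def Q_def h_def using assms(1,2) finite_subset by (intro Pi_pmf_union) auto
  moreover have "J \<union> (I - J) = I"
    using assms(2) by blast
  ultimately have Pi: "Pi_pmf I d p = map_pmf h (pair_pmf P Q)"
    by simp
  have int: "(\<integral>\<^sup>+f. w f \<partial>Pi_pmf I d p) = (\<integral>\<^sup>+f. \<integral>\<^sup>+g. w (h (f, g)) \<partial>Q \<partial>P)" for w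
    unfolding Pi by (simp add: nn_integral_pair_pmf')
  have uh: "u (h (f, g)) = u f" and vh: "v (h (f, g)) = v g" for f g
    by (rule u v; simp add: h_def)+
  show ?thesis
    unfolding int uh vh
    by (simp add: nn_integral_cmult nn_integral_multc)
qed

lemma nn_integral_Pi_pmf_prod:
  fixes g :: "'w \<Rightarrow> ('i \<Rightarrow> 'b) \<Rightarrow> ennreal"
  assumes "finite W" "finite I" "\<And>w. w \<in> W \<Longrightarrow> J w \<subseteq> I" "disjoint_family_on J W"
    and "\<And>w f f'. w \<in> W \<Longrightarrow> (\<And>e. e \<in> J w \<Longrightarrow> f e = f' e) \<Longrightarrow> g w f = g w f'"
  shows "(\<integral>\<^sup>+f. (\<Prod>w\<in>W. g w f) \<partial>Pi_pmf I d p) = (\<Prod>w\<in>W. \<integral>\<^sup>+f. g w f \<partial>Pi_pmf I d p)"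
  using assms(1,3-)
proof (induction W rule: finite_induct)
  case empty
  then show ?case
    by simp
next
  case (insert w W)
  have "J w \<subseteq> I"
    using insert.prems(1) by simp
  moreover have "g w f = g w f'" if "\<And>e. e \<in> J w \<Longrightarrow> f e = f' e" for f f'
    by (rule insert.prems(3)[OF insertI1 that])
  moreover have "(\<Prod>w\<in>W. g w f) = (\<Prod>w\<in>W. g w f')" if "\<And>e. e \<notin> J w \<Longrightarrow> f e = f' e" for f f'
  proof (rule prod.cong[OF refl])
    fix w' assume w': "w' \<in> W"
    have "J w' \<inter> J w = {}"
      by (rule disjoint_family_onD[OF insert.prems(2)]) (use w' insert.hyps in auto)
    then show "g w' f = g w' f'"
      using that by (intro insert.prems(3)[OF insertI2[OF w']]) blast
  qed
  ultimately have "(\<integral>\<^sup>+f. g w f * (\<Prod>w\<in>W. g w f) \<partial>Pi_pmf I d p) =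
      (\<integral>\<^sup>+f. g w f \<partial>Pi_pmf I d p) * (\<integral>\<^sup>+f. (\<Prod>w\<in>W. g w f) \<partial>Pi_pmf I d p)"
    by (rule nn_integral_Pi_pmf_mult[OF assms(2)])
  moreover have disj: "disjoint_family_on J W"
    using insert.prems(2) by (auto simp: disjoint_family_on_def)
  have "(\<integral>\<^sup>+f. (\<Prod>w\<in>W. g w f) \<partial>Pi_pmf I d p) = (\<Prod>w\<in>W. \<integral>\<^sup>+f. g w f \<partial>Pi_pmf I d p)"
  proof (rule insert.IH[OF _ disj])
    show "J w' \<subseteq> I" if "w' \<in> W" for w'
      using that by (intro insert.prems(1)) simp
    show "g w' f = g w' f'" if "w' \<in> W" "\<And>e. e \<in> J w' \<Longrightarrow> f e = f' e" for w' f f'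
      by (rule insert.prems(3)[OF insertI2[OF that(1)] that(2)])
  qed
  ultimately show ?case
    using insert.hyps by simp
qed

section \<open>Star events and their lower tail\<close>

lemma prob_Pi_bernoulli_all_false:
  assumes "finite I" "T \<subseteq> I" "0 \<le> p" "p \<le> 1"
  shows "measure_pmf.prob (Pi_pmf I False (\<lambda>_. bernoulli_pmf p)) {f. \<forall>e\<in>T. \<not> f e} = (1 - p) ^ card T"
proof -
  have "{f. \<forall>e\<in>T. \<not> f e} = Pi I (\<lambda>e. if e \<in> T then {False} else UNIV)"
    using assms(2) by (auto simp: Pi_def)
  then have "measure_pmf.prob (Pi_pmf I False (\<lambda>_. bernoulli_pmf p)) {f. \<forall>e\<in>T. \<not> f e} =
      (\<Prod>e\<in>I. measure_pmf.prob (bernoulli_pmf p) (if e \<in> T then {False} else UNIV))"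
    using assms(1) by (simp only: measure_Pi_pmf_Pi)
  also have "\<dots> = (\<Prod>e\<in>I. if e \<in> T then 1 - p else 1)"
    using assms(3,4) by (intro prod.cong) (auto simp: measure_pmf_single)
  also have "\<dots> = (1 - p) ^ card T"
    using assms(1,2) by (simp add: prod.If_cases Int_absorb1)
  finally show ?thesis .
qed

lemma prob_Pi_bernoulli_star:
  assumes "finite I" "T \<subseteq> I" "x \<in> I" "x \<notin> T" "0 \<le> p" "p \<le> 1"
  shows "measure_pmf.prob (Pi_pmf I False (\<lambda>_. bernoulli_pmf p)) {f. f x \<and> (\<exists>e\<in>T. f e)} =
    p * (1 - (1 - p) ^ card T)"
proof -
  let ?P = "measure_pmf.prob (Pi_pmf I False (\<lambda>_. bernoulli_pmf p))"
  have "finite T"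
    using assms(1,2) finite_subset by blast
  \<comment> \<open>Only all-false events occur on the right, so every probability is a power of
    \<open>1 - p\<close>.\<close>
  have "{f. f x \<and> (\<exists>e\<in>T. f e)} = - {f. \<forall>e\<in>T. \<not> f e} - ({f. \<forall>e\<in>{x}. \<not> f e} - {f. \<forall>e\<in>insert x T. \<not> f e})"
    by auto
  also have "?P \<dots> = ?P (- {f. \<forall>e\<in>T. \<not> f e}) - ?P ({f. \<forall>e\<in>{x}. \<not> f e} - {f. \<forall>e\<in>insert x T. \<not> f e})"
    by (rule measure_pmf.finite_measure_Diff) auto
  also have "?P (- {f. \<forall>e\<in>T. \<not> f e}) = 1 - (1 - p) ^ card T"
    using prob_Pi_bernoulli_all_false[OF assms(1,2,5,6)]
      measure_pmf.prob_compl[of "{f. \<forall>e\<in>T. \<not> f e}" "Pi_pmf I False (\<lambda>_. bernoulli_pmf p)"]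
    by (simp add: Compl_eq_Diff_UNIV)
  also have "?P ({f. \<forall>e\<in>{x}. \<not> f e} - {f. \<forall>e\<in>insert x T. \<not> f e}) =
      ?P {f. \<forall>e\<in>{x}. \<not> f e} - ?P {f. \<forall>e\<in>insert x T. \<not> f e}"
    by (rule measure_pmf.finite_measure_Diff) auto
  also have "\<dots> = (1 - p) - (1 - p) ^ Suc (card T)"
    using assms \<open>finite T\<close> by (subst (1 2) prob_Pi_bernoulli_all_false) auto
  finally show ?thesis
    by (simp add: algebra_simps)
qed

text \<open>Chernoff's method: the exponential moment of minus the count factorises over the disjoint
  blocks. Since \<open>p\<close> may tend to zero, a bound of Hoeffding type would be too weak.\<close>

lemma star_count_tail:
  fixes k :: real
  assumes I: "finite I" and W: "finite W" and p: "0 \<le> p" "p \<le> 1"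
    and h: "\<And>w. w \<in> W \<Longrightarrow> h w \<in> I" "\<And>w. w \<in> W \<Longrightarrow> T w \<subseteq> I" "\<And>w. w \<in> W \<Longrightarrow> h w \<notin> T w"
    and disj: "disjoint_family_on (\<lambda>w. insert (h w) (T w)) W"
    and m: "\<And>w. w \<in> W \<Longrightarrow> card (T w) = m"
  shows "measure_pmf.prob (Pi_pmf I False (\<lambda>_. bernoulli_pmf p))
      {f. real (card {w\<in>W. f (h w) \<and> (\<exists>e\<in>T w. f e)}) \<le> k}
    \<le> exp (k - real (card W) * (p * (1 - (1 - p) ^ m)) / 2)"
proof -
  let ?M = "Pi_pmf I False (\<lambda>_. bernoulli_pmf p)"
  define q where "q = p * (1 - (1 - p) ^ m)"
  define E where "E = (\<lambda>w. {f. f (h w) \<and> (\<exists>e\<in>T w. f e)})"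
  define g where "g = (\<lambda>w f. if f \<in> E w then ennreal (exp (-1)) else 1)"
  have q: "0 \<le> q" "q \<le> 1"
    using p by (auto simp: q_def mult_le_one power_le_one)
  have "(\<integral>\<^sup>+f. g w f \<partial>?M) \<le> ennreal (exp (- (q / 2)))" if w: "w \<in> W" for w
  proof -
    have E: "measure_pmf.prob ?M (E w) = q"
      unfolding E_def q_def using prob_Pi_bernoulli_star[OF I h(2)[OF w] h(1)[OF w] h(3)[OF w] p] m[OF w] by simp
    have "(\<integral>\<^sup>+f. g w f \<partial>?M) = (\<integral>\<^sup>+f. ennreal (exp (-1)) * indicator (E w) f + indicator (- E w) f \<partial>?M)"
      by (intro nn_integral_cong) (auto simp: g_def)
    also have "\<dots> = ennreal (exp (-1)) * emeasure ?M (E w) + emeasure ?M (- E w)"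
      by (subst nn_integral_add) (auto simp: nn_integral_cmult)
    also have "emeasure ?M (E w) = ennreal q"
      using E by (simp add: measure_pmf.emeasure_eq_measure)
    also have "emeasure ?M (- E w) = ennreal (1 - q)"
      using E measure_pmf.prob_compl[of "E w" ?M]
      by (simp add: measure_pmf.emeasure_eq_measure Compl_eq_Diff_UNIV)
    also have "ennreal (exp (-1)) * ennreal q + ennreal (1 - q) = ennreal (exp (-1) * q + (1 - q))"
      using q by (simp add: ennreal_mult ennreal_plus)
    \<comment> \<open>By \<open>exp (-1) \<le> 1 / 2\<close> the left side is at most
      \<open>1 - q / 2\<close>.\<close>
    also have "exp (-1) * q + (1 - q) \<le> exp (- (q / 2))"
    proof -
      have "exp (-1 :: real) \<le> 1 / 2"
        using exp_ge_add_one_self[of 1] by (simp add: exp_minus field_simps)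
      then have "exp (-1) * q \<le> 1 / 2 * q"
        using q(1) by (rule mult_right_mono)
      then show ?thesis
        using exp_ge_add_one_self[of "- (q / 2)"] by linarith
    qed
    finally show ?thesis
      by (simp add: ennreal_leI)
  qed
  then have "(\<Prod>w\<in>W. \<integral>\<^sup>+f. g w f \<partial>?M) \<le> (\<Prod>w\<in>W. ennreal (exp (- (q / 2))))"
    by (intro prod_mono_ennreal)
  moreover have "(\<integral>\<^sup>+f. (\<Prod>w\<in>W. g w f) \<partial>?M) = (\<Prod>w\<in>W. \<integral>\<^sup>+f. g w f \<partial>?M)"
  proof (rule nn_integral_Pi_pmf_prod[OF W I _ disj])
    show "insert (h w) (T w) \<subseteq> I" if "w \<in> W" for w
      using h(1,2)[OF that] by simp
    show "g w f = g w f'" if "\<And>e. e \<in> insert (h w) (T w) \<Longrightarrow> f e = f' e" for w f f'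
    proof -
      have "f (h w) \<longleftrightarrow> f' (h w)" "(\<exists>e\<in>T w. f e) \<longleftrightarrow> (\<exists>e\<in>T w. f' e)"
        by (intro that bex_cong; simp)+
      then show ?thesis
        by (simp add: g_def E_def)
    qed
  qed
  ultimately have int: "(\<integral>\<^sup>+f. (\<Prod>w\<in>W. g w f) \<partial>?M) \<le> ennreal (exp (- (q / 2))) ^ card W"
    by simp
  have "emeasure ?M {f. real (card {w\<in>W. f \<in> E w}) \<le> k} =
      (\<integral>\<^sup>+f. indicator {f. real (card {w\<in>W. f \<in> E w}) \<le> k} f \<partial>?M)"
    by simp
  also have "\<dots> \<le> (\<integral>\<^sup>+f. ennreal (exp k) * (\<Prod>w\<in>W. g w f) \<partial>?M)"
  proof (rule nn_integral_mono)
    fix f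
    have "(\<Prod>w\<in>W. g w f) = ennreal (exp (-1)) ^ card {w\<in>W. f \<in> E w}"
      using W by (simp add: g_def prod.If_cases Int_def)
    then have *: "ennreal (exp k) * (\<Prod>w\<in>W. g w f) = ennreal (exp (k - card {w\<in>W. f \<in> E w}))"
      by (simp add: ennreal_power flip: ennreal_mult exp_of_nat_mult exp_add)
    \<comment> \<open>Markov's inequality, pointwise: a count of at most \<open>k\<close> makes the
      exponent nonnegative.\<close>
    show "indicator {f. real (card {w\<in>W. f \<in> E w}) \<le> k} f \<le> ennreal (exp k) * (\<Prod>w\<in>W. g w f)"
      unfolding * by (auto simp: indicator_def)
  qed
  also have "\<dots> = ennreal (exp k) * (\<integral>\<^sup>+f. (\<Prod>w\<in>W. g w f) \<partial>?M)"
    by (simp add: nn_integral_cmult)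
  also have "\<dots> \<le> ennreal (exp k) * ennreal (exp (- (q / 2))) ^ card W"
    by (intro mult_left_mono int) simp
  also have "\<dots> = ennreal (exp (k - card W * q / 2))"
    by (simp add: ennreal_power flip: ennreal_mult exp_of_nat_mult exp_add)
  finally have "measure_pmf.prob ?M {f. real (card {w\<in>W. f \<in> E w}) \<le> k} \<le> exp (k - card W * q / 2)"
    by (simp add: measure_pmf.emeasure_eq_measure)
  then show ?thesis
    by (simp add: E_def q_def)
qed

section \<open>Expansion and density as events of independent edges\<close>

definition edge_pairs :: "'v set \<Rightarrow> 'v set \<Rightarrow> 'v set set" where
  "edge_pairs A B = (\<lambda>(a, b). {a, b}) ` (A \<times> B)"

definition expands :: "nat \<Rightarrow> 'v set \<Rightarrow> 'v set \<Rightarrow> ('v set \<Rightarrow> bool) \<Rightarrow> bool" where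
  "expands t A B f \<longleftrightarrow> (\<forall>x\<in>A. \<forall>S. S \<subseteq> A - {x} \<longrightarrow>
     8 * min (card S) t \<le> card {b \<in> B. f {x, b} \<and> (\<exists>y\<in>S. f {y, b})})"

definition joins_large_sets :: "nat \<Rightarrow> 'v set \<Rightarrow> 'v set \<Rightarrow> ('v set \<Rightarrow> bool) \<Rightarrow> bool" where
  "joins_large_sets t A B f \<longleftrightarrow> (\<forall>X Y. X \<subseteq> A \<longrightarrow> Y \<subseteq> B \<longrightarrow> t \<le> card X \<longrightarrow> t \<le> card Y \<longrightarrow>
     (\<exists>x\<in>X. \<exists>y\<in>Y. f {x, y}))"

lemma edge_pairs_commute: "edge_pairs A B = edge_pairs B A"
  by (force simp: edge_pairs_def insert_commute)

lemma finite_edge_pairs: "finite A \<Longrightarrow> finite B \<Longrightarrow> finite (edge_pairs A B)"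
  by (simp add: edge_pairs_def)

lemma edge_pairs_mono: "X \<subseteq> A \<Longrightarrow> Y \<subseteq> B \<Longrightarrow> edge_pairs X Y \<subseteq> edge_pairs A B"
  by (auto simp: edge_pairs_def)

lemma in_edge_pairs: "a \<in> A \<Longrightarrow> b \<in> B \<Longrightarrow> {a, b} \<in> edge_pairs A B"
  by (auto simp: edge_pairs_def)

lemma card_edge_pairs:
  assumes "A \<inter> B = {}"
  shows "card (edge_pairs A B) = card A * card B"
proof -
  have "inj_on (\<lambda>(a, b). {a, b}) (A \<times> B)"
    using assms by (auto simp: inj_on_def doubleton_eq_iff)
  then show ?thesis
    by (simp add: edge_pairs_def card_image card_cartesian_product)
qed

text \<open>Each \<open>b\<close> owns its edges to \<open>x\<close> and \<open>S\<close>, so these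
  stars are independent. As \<open>p * card S \<le> 1\<close>, each has probability at least
  \<open>p\<^sup>2 * card S / 2\<close>, so the threshold is at most a quarter of the mean.\<close>

lemma common_nbhd_tail:
  fixes p :: real
  assumes AB: "finite A" "finite B" "A \<inter> B = {}" and x: "x \<in> A" and S: "S \<subseteq> A - {x}"
    and p: "0 \<le> p" "p \<le> 1" and m: "p * card S \<le> 1"
  shows "measure_pmf.prob (Pi_pmf (edge_pairs A B) False (\<lambda>_. bernoulli_pmf p))
      {f. real (card {b \<in> B. f {x, b} \<and> (\<exists>y\<in>S. f {y, b})}) \<le> card B * p\<^sup>2 * card S / 8}
    \<le> exp (- (card B * p\<^sup>2 * card S / 8))"
proof -
  define T where "T = (\<lambda>b. (\<lambda>y. {y, b}) ` S)"
  define q where "q = p * (1 - (1 - p) ^ card S)"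
  let ?k = "real (card B) * p\<^sup>2 * real (card S) / 8"
  have "measure_pmf.prob (Pi_pmf (edge_pairs A B) False (\<lambda>_. bernoulli_pmf p))
      {f. real (card {b \<in> B. f {x, b} \<and> (\<exists>e\<in>T b. f e)}) \<le> ?k} \<le> exp (?k - card B * q / 2)"
    unfolding q_def
  proof (rule star_count_tail)
    show "disjoint_family_on (\<lambda>b. insert {x, b} (T b)) B"
      using AB(3) x S by (fastforce simp: disjoint_family_on_def T_def doubleton_eq_iff)
    show "card (T b) = card S" if "b \<in> B" for b
      unfolding T_def using that AB(3) S by (intro card_image) (auto simp: inj_on_def doubleton_eq_iff)
    show "{x, b} \<notin> T b" if "b \<in> B" for b
      using that AB(3) S x by (auto simp: T_def doubleton_eq_iff)
    show "T b \<subseteq> edge_pairs A B" if "b \<in> B" for b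
      using that S by (auto simp: T_def intro: in_edge_pairs)
  qed (use AB p x in_edge_pairs finite_edge_pairs in auto)
  also have "?k - card B * q / 2 \<le> - ?k"
  proof -
    define z where "z = p * card S"
    have z: "0 \<le> z" "z \<le> 1"
      using p m by (auto simp: z_def)
    have "(1 - p) ^ card S \<le> exp (- p) ^ card S"
      using p exp_ge_add_one_self[of "- p"] by (intro power_mono) auto
    also have "\<dots> = exp (- z)"
      by (simp add: z_def mult.commute flip: exp_of_nat_mult)
    also have "\<dots> \<le> 1 / (1 + z)"
      using exp_ge_add_one_self[of z] z by (simp add: exp_minus inverse_eq_divide frac_le)
    also have "\<dots> \<le> 1 - z / 2"
      using z mult_left_le[of z z] by (simp add: divide_simps algebra_simps)
    finally have "p * (z / 2) \<le> q"
      unfolding q_def using p by (intro mult_left_mono) auto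
    then have "card B * (p * (z / 2)) \<le> card B * q"
      by (intro mult_left_mono) auto
    then show ?thesis
      by (simp add: z_def power2_eq_square algebra_simps)
  qed
  finally show ?thesis
    by (simp add: T_def)
qed

text \<open>For small \<open>S\<close>, \<open>64 = 8 * 8\<close> gives more than
  \<open>8 * card S\<close> common neighbours. For larger \<open>S\<close>, a subset of at least
  \<open>1 / (2 * p)\<close> elements gives more than \<open>card B * p / 16\<close>, and
  \<open>128 = 16 * 8\<close>.\<close>

lemma expands_if_common_nbhds_large:
  fixes p :: real
  assumes A: "finite A" and B: "finite B" and p: "0 < p" "p \<le> 1"
    and deg: "64 \<le> card B * p\<^sup>2" "128 * t \<le> card B * p"
    and large: "\<And>x S. x \<in> A \<Longrightarrow> S \<subseteq> A - {x} \<Longrightarrow> S \<noteq> {} \<Longrightarrow> p * card S \<le> 1 \<Longrightarrow>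
      card B * p\<^sup>2 * card S / 8 < card {b \<in> B. f {x, b} \<and> (\<exists>y\<in>S. f {y, b})}"
  shows "expands t A B f"
  unfolding expands_def
proof (intro ballI allI impI)
  fix x S assume x: "x \<in> A" and S: "S \<subseteq> A - {x}"
  let ?N = "\<lambda>S. {b \<in> B. f {x, b} \<and> (\<exists>y\<in>S. f {y, b})}"
  consider "S = {}" | "S \<noteq> {}" "p * card S \<le> 1" | "1 < p * card S"
    by linarith
  then show "8 * min (card S) t \<le> card (?N S)"
  proof cases
    case 1
    then show ?thesis
      by simp
  next
    case 2
    have "64 * real (card S) \<le> card B * p\<^sup>2 * card S"
      using deg(1) by (intro mult_right_mono) auto
    then have "real (8 * card S) < card (?N S)"
      using large[OF x S 2] by simp
    then show ?thesis
      by simp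
  next
    case 3
    \<comment> \<open>The tail bound is only linear in \<open>card S\<close> up to \<open>1 / p\<close>; beyond, a subset of that size suffices.\<close>
    define m where "m = nat \<lfloor>1 / p\<rfloor>"
    have "1 \<le> \<lfloor>1 / p\<rfloor>"
      using p by (simp add: le_floor_iff)
    moreover from this have "real m = \<lfloor>1 / p\<rfloor>"
      unfolding m_def by (intro of_nat_nat) linarith
    ultimately have m: "1 \<le> m" "real m \<le> 1 / p" "1 / p < real m + 1"
      by linarith+
    have "1 / p < card S"
      using 3 p by (simp add: field_simps)
    then have "m \<le> card S"
      using m(2) by linarith
    then obtain S' where S': "S' \<subseteq> S" "card S' = m"
      by (metis obtain_subset_with_card_n)
    have "p * card S' \<le> 1"
      using m(2) p by (simp add: S' field_simps)
    moreover have "S' \<noteq> {}"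
      using S' m(1) by auto
    ultimately have *: "card B * p\<^sup>2 * m / 8 < card (?N S')"
      using large[OF x, of S'] S S' by auto
    \<comment> \<open>Rounding \<open>1 / p \<ge> 1\<close> down at most halves it.\<close>
    have "1 / (2 * p) \<le> m"
    proof -
      define u where "u = 1 / p"
      have "u / 2 \<le> m"
        using m unfolding u_def[symmetric] by linarith
      then show ?thesis
        by (simp add: u_def)
    qed
    then have "card B * p\<^sup>2 * (1 / (2 * p)) \<le> card B * p\<^sup>2 * m"
      by (intro mult_left_mono) auto
    moreover have "card B * p\<^sup>2 * (1 / (2 * p)) = card B * p / 2"
      using p by (simp add: power2_eq_square)
    ultimately have "card B * p / 2 \<le> card B * p\<^sup>2 * m"
      by (simp only:)
    then have "real (8 * t) < card (?N S')"
      using * deg(2) by linarith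
    also have "card (?N S') \<le> card (?N S)"
      using S'(1) B by (intro card_mono) auto
    finally show ?thesis
      by simp
  qed
qed

text \<open>Union bound over \<open>x\<close> and \<open>S\<close>, a set \<open>S\<close> costing
  \<open>y ^ card S\<close>. The binomial theorem sums this to \<open>(1 + y) ^ n - 1\<close>, at
  most \<open>2 * n * y\<close>, and \<open>y\<close> is at most the inverse cube of
  \<open>n\<close>.\<close>

lemma prob_not_expands_le:
  fixes p :: real
  assumes AB: "finite A" "finite B" "A \<inter> B = {}" "card A = n" "card B = n"
    and p: "0 < p" "p \<le> 1" and n: "1 \<le> ln n" "512 * ln n \<le> n * p\<^sup>2" and t: "t \<le> 4 * ln n / p"
  shows "measure_pmf.prob (Pi_pmf (edge_pairs A B) False (\<lambda>_. bernoulli_pmf p))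
      {f. \<not> expands t A B f} \<le> 2 / n"
proof -
  let ?M = "Pi_pmf (edge_pairs A B) False (\<lambda>_. bernoulli_pmf p)"
  define bad where "bad = (\<lambda>(x, S). {f. card {b \<in> B. f {x, b} \<and> (\<exists>y\<in>S. f {y, b})} \<le> n * p\<^sup>2 * card S / 8})"
  define J where "J = {(x, S). x \<in> A \<and> S \<subseteq> A - {x} \<and> S \<noteq> {} \<and> p * card S \<le> 1}"
  define y :: real where "y = exp (- (n * p\<^sup>2 / 8))"
  have n0: "0 < real n"
    using n(1) by (cases "n = 0") auto
  have y: "0 \<le> y" "y \<le> 1 / real n ^ 3"
  proof -
    show "0 \<le> y"
      by (simp add: y_def)
    have "y \<le> exp (- (3 * ln n))"
      using n by (simp add: y_def)
    also have "\<dots> = 1 / exp (ln n) ^ 3"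
      by (simp add: exp_minus inverse_eq_divide flip: exp_of_nat_mult)
    finally show "y \<le> 1 / real n ^ 3"
      using n0 by simp
  qed
  have "128 * t \<le> n * p"
  proof -
    have "128 * real t * p \<le> 512 * ln n"
      using t p by (simp add: field_simps)
    also have "\<dots> \<le> (n * p) * p"
      using n(2) by (simp add: power2_eq_square mult.assoc)
    finally show ?thesis
      using p(1) by simp
  qed
  moreover have "64 \<le> n * p\<^sup>2"
    using n by linarith
  ultimately have "{f. \<not> expands t A B f} \<subseteq> (\<Union>j\<in>J. bad j)"
    using expands_if_common_nbhds_large[OF AB(1,2) p, of t] AB(5)
    by (fastforce simp: J_def bad_def not_less)
  moreover have J: "J \<subseteq> A \<times> (Pow A - {{}})" "finite J"
  proof -
    show "J \<subseteq> A \<times> (Pow A - {{}})"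
      by (auto simp: J_def)
    then show "finite J"
      using AB(1) by (meson finite_Diff finite_Pow_iff finite_SigmaI finite_subset)
  qed
  ultimately have "measure_pmf.prob ?M {f. \<not> expands t A B f} \<le> measure_pmf.prob ?M (\<Union>j\<in>J. bad j)"
    by (intro measure_pmf.finite_measure_mono) auto
  also have "\<dots> \<le> (\<Sum>j\<in>J. measure_pmf.prob ?M (bad j))"
    using J(2) by (intro measure_pmf.finite_measure_subadditive_finite) auto
  also have "\<dots> \<le> (\<Sum>(x, S)\<in>J. y ^ card S)"
  proof (intro sum_mono)
    fix j assume "j \<in> J"
    then obtain x S where j: "j = (x, S)" "x \<in> A" "S \<subseteq> A - {x}" "p * card S \<le> 1"
      by (auto simp: J_def)
    have "measure_pmf.prob ?M (bad j) \<le> exp (- (n * p\<^sup>2 * card S / 8))"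
      using common_nbhd_tail[OF AB(1-3) j(2,3) _ p(2) j(4)] p(1) AB(5) by (simp add: bad_def j)
    also have "\<dots> = y ^ card S"
      by (simp add: y_def mult_ac flip: exp_of_nat_mult)
    finally show "measure_pmf.prob ?M (bad j) \<le> (case j of (x, S) \<Rightarrow> y ^ card S)"
      by (simp add: j)
  qed
  also have "\<dots> \<le> (\<Sum>(x, S)\<in>A \<times> (Pow A - {{}}). y ^ card S)"
    using J(1) AB(1) y(1) by (intro sum_mono2) auto
  also have "\<dots> = n * (\<Sum>S\<in>Pow A - {{}}. y ^ card S)"
    using AB(4) by (simp flip: sum.cartesian_product)
  also have "(\<Sum>S\<in>Pow A - {{}}. y ^ card S) = (1 + y) ^ n - 1"
  proof -
    have "(1 + y) ^ n = (\<Prod>x\<in>A. y + 1)"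
      using AB(4) by (simp add: add.commute)
    also have "\<dots> = (\<Sum>S\<in>Pow A. y ^ card S)"
      by (subst prod_add[OF AB(1)]) simp
    also have "\<dots> = (\<Sum>S\<in>Pow A - {{}}. y ^ card S) + 1"
      using AB(1) by (subst sum.remove[of _ "{}"]) auto
    finally show ?thesis
      by simp
  qed
  also have "n * ((1 + y) ^ n - 1) \<le> n * (2 * (n * y))"
  proof (rule mult_left_mono)
    have "2 \<le> real n"
      using n0 n(1) ln_le_minus_one[of "real n"] by linarith
    then have "2 * 1 \<le> real n * real n"
      by (intro mult_mono) auto
    moreover have "n * y \<le> n * (1 / real n ^ 3)"
      using y(2) by (intro mult_left_mono) auto
    moreover have "n * (1 / real n ^ 3) = 1 / (real n * real n)"
      using n0 by (simp add: power3_eq_cube)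
    ultimately have ny: "n * y \<le> 1 / 2"
      by (smt (verit) frac_le)
    have "(1 + y) ^ n \<le> exp y ^ n"
      using y(1) by (intro power_mono) auto
    also have "\<dots> = exp (n * y)"
      by (simp flip: exp_of_nat_mult)
    also have "\<dots> \<le> 1 + 2 * (n * y)"
      using ny y(1) by (intro real_exp_bound_lemma) auto
    finally show "(1 + y) ^ n - 1 \<le> 2 * (n * y)"
      by simp
  qed simp
  also have "\<dots> \<le> n * (2 * (n * (1 / real n ^ 3)))"
    using y(2) by (intro mult_left_mono) auto
  also have "\<dots> = 2 / n"
    using n0 by (simp add: power3_eq_cube)
  finally show ?thesis .
qed

text \<open>Union bound over pairs of sets of size exactly \<open>t\<close>: at most
  \<open>n ^ (2 * t)\<close> pairs, each edgeless with probability at most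
  \<open>exp (- (p * t * t))\<close>. As \<open>p * t \<ge> 3 * ln n\<close>, the total is at most
  \<open>exp (- (t * ln n))\<close>.\<close>

lemma prob_not_joins_large_sets_le:
  fixes p :: real
  assumes AB: "finite A" "finite B" "A \<inter> B = {}" "card A = n" "card B = n"
    and p: "0 < p" "p \<le> 1" and n: "1 \<le> ln n" and t: "3 * ln n / p \<le> t" "t \<le> n"
  shows "measure_pmf.prob (Pi_pmf (edge_pairs A B) False (\<lambda>_. bernoulli_pmf p))
      {f. \<not> joins_large_sets t A B f} \<le> 1 / n"
proof -
  let ?M = "Pi_pmf (edge_pairs A B) False (\<lambda>_. bernoulli_pmf p)"
  define bad where "bad = (\<lambda>(X, Y). {f :: 'a set \<Rightarrow> bool. \<forall>e\<in>edge_pairs X Y. \<not> f e})"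
  define J where "J = {X. X \<subseteq> A \<and> card X = t} \<times> {Y. Y \<subseteq> B \<and> card Y = t}"
  have n0: "0 < real n"
    using n by (cases "n = 0") auto
  have "0 < 3 * ln n / p"
    using n p by simp
  then have t0: "1 \<le> real t"
    using t(1) by (cases t) auto
  have J: "finite J" "card J = (n choose t) * (n choose t)"
    using AB by (simp_all add: J_def card_cartesian_product n_subsets)
  have "{f. \<not> joins_large_sets t A B f} \<subseteq> (\<Union>j\<in>J. bad j)"
  proof
    fix f assume "f \<in> {f. \<not> joins_large_sets t A B f}"
    then obtain X Y where XY: "X \<subseteq> A" "Y \<subseteq> B" "t \<le> card X" "t \<le> card Y"
      "\<And>x y. x \<in> X \<Longrightarrow> y \<in> Y \<Longrightarrow> \<not> f {x, y}"
      unfolding joins_large_sets_def by blast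
    obtain X' Y' where X'Y': "X' \<subseteq> X" "card X' = t" "Y' \<subseteq> Y" "card Y' = t"
      using XY(3,4) by (metis obtain_subset_with_card_n)
    then have "(X', Y') \<in> J"
      using XY(1,2) by (auto simp: J_def)
    moreover have "f \<in> bad (X', Y')"
      using X'Y' XY(5) by (auto simp: bad_def edge_pairs_def)
    ultimately show "f \<in> (\<Union>j\<in>J. bad j)"
      by blast
  qed
  then have "measure_pmf.prob ?M {f. \<not> joins_large_sets t A B f} \<le> measure_pmf.prob ?M (\<Union>j\<in>J. bad j)"
    by (intro measure_pmf.finite_measure_mono) auto
  also have "\<dots> \<le> (\<Sum>j\<in>J. measure_pmf.prob ?M (bad j))"
    using J(1) by (intro measure_pmf.finite_measure_subadditive_finite) auto
  also have "\<dots> \<le> (\<Sum>j\<in>J. exp (- (p * t * t)))"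
  proof (rule sum_mono)
    fix j assume "j \<in> J"
    then obtain X Y where j: "j = (X, Y)" "X \<subseteq> A" "Y \<subseteq> B" "card X = t" "card Y = t"
      by (auto simp: J_def)
    have "X \<inter> Y = {}"
      using j AB(3) by blast
    then have "measure_pmf.prob ?M (bad j) = (1 - p) ^ (t * t)"
      using prob_Pi_bernoulli_all_false[OF finite_edge_pairs[OF AB(1,2)] edge_pairs_mono[OF j(2,3)]] p j
      by (simp add: bad_def card_edge_pairs)
    also have "\<dots> \<le> exp (- p) ^ (t * t)"
      using p exp_ge_add_one_self[of "- p"] by (intro power_mono) auto
    also have "\<dots> = exp (- (p * t * t))"
      by (simp add: mult_ac flip: exp_of_nat_mult)
    finally show "measure_pmf.prob ?M (bad j) \<le> exp (- (p * t * t))" .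
  qed
  also have "\<dots> = (n choose t) * (n choose t) * exp (- (p * t * t))"
    by (simp add: J(2))
  also have "\<dots> \<le> n ^ t * n ^ t * exp (- (p * t * t))"
    using binomial_le_pow[OF t(2)] by (intro mult_right_mono) (auto intro: mult_mono simp flip: of_nat_mult of_nat_power)
  also have "\<dots> = exp (2 * t * ln n - p * t * t)"
  proof -
    have "real n ^ t = exp (t * ln n)"
      using n0 by (simp add: exp_of_nat_mult)
    then show ?thesis
      by (simp add: exp_diff exp_minus field_simps flip: exp_add)
  qed
  also have "\<dots> \<le> exp (- ln n)"
  proof -
    have "3 * ln n * t \<le> p * t * t"
      using t(1) p t0 by (intro mult_right_mono) (auto simp: field_simps)
    moreover have "1 * ln n \<le> t * ln n"
      using t0 n by (intro mult_right_mono) auto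
    ultimately show ?thesis
      by (simp add: algebra_simps)
  qed
  also have "\<dots> = 1 / n"
    using n0 by (simp add: exp_minus inverse_eq_divide)
  finally show ?thesis .
qed

subsection \<open>Monochromatic components\<close>

lemma equiv_joined: "equiv V (joined V E)"
proof (rule equivI)
  show "joined V E \<subseteq> V \<times> V"
    by (auto simp: joined_def)
  show "refl_on V (joined V E)"
    by (auto simp: refl_on_def joined_def)
  have "sym ({(x, y). {x, y} \<in> E}\<^sup>*)"
    by (intro sym_rtrancl) (auto simp: sym_def insert_commute)
  then show "sym (joined V E)"
    by (auto simp: joined_def sym_def)
  show "trans (joined V E)"
    by (auto simp: joined_def trans_def)
qed

text \<open>Components themselves serve as labels; outside \<open>V\<close> the label is the empty
  set.\<close>

definition component_of :: "'v set \<Rightarrow> 'v set set \<Rightarrow> ('v set \<Rightarrow> colour) \<Rightarrow> colour \<Rightarrow> 'v \<Rightarrow> 'v set" where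
  "component_of V E c k v = joined V {e \<in> E. c e = k} `` {v}"

lemma component_of_eq:
  assumes "u \<in> V" "v \<in> V" "{u, v} \<in> E" "c {u, v} = k"
  shows "component_of V E c k u = component_of V E c k v"
proof -
  have "(u, v) \<in> joined V {e \<in> E. c e = k}"
    using assms by (auto simp: joined_def)
  then show ?thesis
    unfolding component_of_def by (rule equiv_class_eq[OF equiv_joined])
qed

lemma component_of_in_mono_components: "v \<in> V \<Longrightarrow> component_of V E c k v \<in> mono_components V E c"
  by (auto simp: component_of_def mono_components_def graph_components_def intro: quotientI)

lemma in_component_of: "v \<in> V \<Longrightarrow> v \<in> component_of V E c k v"
  unfolding component_of_def by (rule equiv_class_self[OF equiv_joined])

text \<open>The label of a class without vertices in \<open>V\<close> need not be a component; the
  empty family covers it, hence \<open>card K \<le> 1\<close>.\<close>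

lemma class_covered_by_component:
  assumes "X \<in> classes (component_of V E c Red) (component_of V E c Blue)"
  obtains K where "K \<subseteq> mono_components V E c" "finite K" "card K \<le> 1" "V \<inter> X \<subseteq> \<Union>K"
proof -
  obtain k i where X: "X = component_of V E c k -` {i}"
    using assms by (auto simp: classes_def)
  show ?thesis
  proof (cases "V \<inter> X = {}")
    case True
    then show ?thesis
      using that[of "{}"] by simp
  next
    case False
    then obtain v where "v \<in> V" "i = component_of V E c k v"
      by (auto simp: X)
    then have "i \<in> mono_components V E c"
      by (simp add: component_of_in_mono_components)
    moreover have "V \<inter> X \<subseteq> i"
      using in_component_of by (auto simp: X)
    ultimately show ?thesis
      using that[of "{i}"] by simp
  qed
qed

lemma mono_coverable_if_three_coverable:
  assumes "three_coverable V (component_of V E c Red) (component_of V E c Blue)"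
  shows "mono_coverable 3 V E c"
proof -
  let ?classes = "classes (component_of V E c Red) (component_of V E c Blue)"
  obtain X Y Z where XYZ: "X \<in> ?classes" "Y \<in> ?classes" "Z \<in> ?classes" "V \<subseteq> X \<union> Y \<union> Z"
    using assms unfolding three_coverable_def by blast
  obtain K L M where
    K: "K \<subseteq> mono_components V E c" "finite K" "card K \<le> 1" "V \<inter> X \<subseteq> \<Union>K" and
    L: "L \<subseteq> mono_components V E c" "finite L" "card L \<le> 1" "V \<inter> Y \<subseteq> \<Union>L" and
    M: "M \<subseteq> mono_components V E c" "finite M" "card M \<le> 1" "V \<inter> Z \<subseteq> \<Union>M"
    using XYZ(1-3) by (elim class_covered_by_component)
  have "card (K \<union> L \<union> M) \<le> card K + card L + card M"
    by (meson add_mono card_Un_le le_refl order_trans)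
  then have "card (K \<union> L \<union> M) \<le> 3"
    using K(3) L(3) M(3) by linarith
  moreover have "V \<subseteq> \<Union>(K \<union> L \<union> M)"
    using XYZ(4) K(4) L(4) M(4) by blast
  ultimately show ?thesis
    unfolding mono_coverable_def using K(1,2) L(1,2) M(1,2)
    by (intro exI[of _ "K \<union> L \<union> M"]) simp
qed

text \<open>The hypotheses concern \<open>f\<close> alone, so one good graph serves all colourings.
  An edge has equal components of its own colour at both ends, which is the axiom
  \<open>share\<close>.\<close>

lemma mono_coverable_if_expands:
  assumes AB: "finite A" "finite B" and t: "0 < t" "t < card A" "t < card B"
    and expands: "expands t A B f" "expands t B A f" and dense: "joins_large_sets t A B f"
  shows "mono_coverable 3 (A \<union> B) {e \<in> edge_pairs A B. f e} c"
proof -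
  let ?E = "{e \<in> edge_pairs A B. f e}"
  interpret expanding_labelling A B "\<lambda>x y. f {x, y}"
    "component_of (A \<union> B) ?E c Red" "component_of (A \<union> B) ?E c Blue" t
  proof
    show "f {y, x}" if "f {x, y}" for x y
      using that by (simp add: insert_commute)
    show "component_of (A \<union> B) ?E c Red a = component_of (A \<union> B) ?E c Red b \<or>
        component_of (A \<union> B) ?E c Blue a = component_of (A \<union> B) ?E c Blue b"
      if "a \<in> A" "b \<in> B" "f {a, b}" for a b
      using that in_edge_pairs[OF that(1,2)]
      by (cases "c {a, b}") (simp_all add: component_of_eq[of a _ b])
    show "8 * min (card S) t \<le> card {b \<in> B. f {x, b} \<and> (\<exists>y\<in>S. f {y, b})}"
      if "x \<in> A" "S \<subseteq> A - {x}" for x S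
      using expands(1) that unfolding expands_def by blast
    show "8 * min (card S) t \<le> card {a \<in> A. f {x, a} \<and> (\<exists>y\<in>S. f {y, a})}"
      if "x \<in> B" "S \<subseteq> B - {x}" for x S
      using expands(2) that unfolding expands_def by blast
    show "\<exists>x\<in>X. \<exists>y\<in>Y. f {x, y}" if "X \<subseteq> A" "Y \<subseteq> B" "t \<le> card X" "t \<le> card Y" for X Y
      using dense that unfolding joins_large_sets_def by blast
  qed (use AB t in auto)
  show ?thesis
    by (rule mono_coverable_if_three_coverable[OF three_coverable])
qed

section \<open>Failure probability and limit\<close>

lemma prob_mono_coverable_ge:
  fixes p :: real
  assumes p: "0 < p" "p \<le> 1" and n: "1 \<le> ln n" "512 * ln n \<le> n * p\<^sup>2"
  shows "1 - 5 / n \<le> measure_pmf.prob (random_bip_graph n p)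
    {E. \<forall>c. mono_coverable 3 (bip_verts n) E c}"
proof -
  define A B :: "(nat + nat) set" where "A = Inl ` {..<n}" and "B = Inr ` {..<n}"
  have AB: "finite A" "finite B" "A \<inter> B = {}" "B \<inter> A = {}" "card A = n" "card B = n"
    by (auto simp: A_def B_def card_image)
  have V: "bip_verts n = A \<union> B"
    by (auto simp: bip_verts_def A_def B_def)
  have E: "bip_pairs n = edge_pairs A B"
    by (auto simp: bip_pairs_def edge_pairs_def A_def B_def)
  define t where "t = nat \<lceil>3 * ln n / p\<rceil>"
  have "1 * p \<le> 1 * ln n"
    using p n by simp
  then have lnp: "1 \<le> ln n / p"
    using p by (simp add: field_simps)
  \<comment> \<open>Rounding up costs at most 1, and \<open>ln n / p \<ge> 1\<close> absorbs it into
    the fourth multiple.\<close>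
  then have t: "3 * ln n / p \<le> t" "t \<le> 4 * ln n / p"
  proof -
    define u where "u = ln n / p"
    have u: "1 \<le> u" "3 * ln n / p = 3 * u" "4 * ln n / p = 4 * u"
      using lnp by (simp_all add: u_def)
    have "0 \<le> \<lceil>3 * u\<rceil>"
      using u(1) by (simp add: le_ceiling_iff)
    then have "real t = \<lceil>3 * u\<rceil>"
      unfolding t_def u(2) by (intro of_nat_nat)
    then show "3 * ln n / p \<le> t" "t \<le> 4 * ln n / p"
      using u ceiling_correct[of "3 * u"] by linarith+
  qed
  have t0: "0 < t"
    using t(1) lnp by (cases t) auto
  have "4 * ln n / p < n"
  proof -
    have "p * p \<le> 1 * p"
      using p by (intro mult_right_mono) auto
    then have "n * p\<^sup>2 \<le> n * p"
      by (intro mult_left_mono) (auto simp: power2_eq_square)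
    then have "4 * ln n < n * p"
      using n by linarith
    then show ?thesis
      using p by (simp add: field_simps)
  qed
  then have tn: "t < n"
    using t(2) by simp
  let ?M = "Pi_pmf (edge_pairs A B) False (\<lambda>_. bernoulli_pmf p)"
  let ?bad = "{f. \<not> expands t A B f} \<union> {f. \<not> expands t B A f} \<union> {f. \<not> joins_large_sets t A B f}"
  have "measure_pmf.prob ?M ?bad \<le> measure_pmf.prob ?M {f. \<not> expands t A B f}
      + measure_pmf.prob ?M {f. \<not> expands t B A f} + measure_pmf.prob ?M {f. \<not> joins_large_sets t A B f}"
    by (intro order_trans[OF measure_Un_le] add_right_mono measure_Un_le) auto
  also have "\<dots> \<le> 2 / n + 2 / n + 1 / n"
    using prob_not_expands_le[OF AB(1,2,3,5,6) p n t(2)] prob_not_expands_le[OF AB(2,1,4,6,5) p n t(2)]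
      prob_not_joins_large_sets_le[OF AB(1,2,3,5,6) p n(1) t(1)] tn
    by (intro add_mono) (simp_all add: edge_pairs_commute[of B A])
  also have "\<dots> = 5 / n"
    by (simp add: field_simps)
  finally have "1 - 5 / n \<le> measure_pmf.prob ?M (UNIV - ?bad)"
    using measure_pmf.prob_compl[of ?bad ?M] by simp
  also have "\<dots> \<le> measure_pmf.prob ?M {f. \<forall>c. mono_coverable 3 (A \<union> B) {e \<in> edge_pairs A B. f e} c}"
    using mono_coverable_if_expands[OF AB(1,2) t0] tn AB(5,6)
    by (intro measure_pmf.finite_measure_mono) auto
  also have "\<dots> = measure_pmf.prob (random_bip_graph n p) {E. \<forall>c. mono_coverable 3 (bip_verts n) E c}"
    by (simp add: random_bip_graph_def E V vimage_def)
  finally show ?thesis .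
qed

theorem theorem1p1:
  fixes p :: "nat \<Rightarrow> real"
  assumes "\<And>n. 0 \<le> p n" and "\<And>n. p n \<le> 1"
    and "filterlim (\<lambda>n. p n / sqrt (ln (real n) / real n)) at_top sequentially"
  shows "(\<lambda>n. measure_pmf.prob (random_bip_graph n (p n))
            {E. \<forall>c. mono_coverable 3 (bip_verts n) E c}) \<longlonglongrightarrow> 1"
proof (rule tendsto_sandwich)
  show "(\<lambda>n. 1 - 5 / real n) \<longlonglongrightarrow> 1"
    by (rule tendsto_eq_intros lim_const_over_n refl | simp)+
  have "filterlim (\<lambda>n. ln (real n)) at_top sequentially"
    by (rule filterlim_compose[OF ln_at_top filterlim_real_sequentially])
  then have "eventually (\<lambda>n. 1 \<le> ln (real n)) sequentially"
    by (simp add: filterlim_at_top)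
  \<comment> \<open>The square of 23 is 529, above the 512 needed for expansion.\<close>
  moreover have "eventually (\<lambda>n. 23 \<le> p n / sqrt (ln (real n) / real n)) sequentially"
    using assms(3) by (simp add: filterlim_at_top)
  ultimately show "eventually (\<lambda>n. 1 - 5 / real n \<le> measure_pmf.prob (random_bip_graph n (p n))
      {E. \<forall>c. mono_coverable 3 (bip_verts n) E c}) sequentially"
  proof eventually_elim
    case (elim n)
    define w where "w = sqrt (ln (real n) / real n)"
    have n: "0 < real n"
      using elim(1) by (cases "n = 0") auto
    then have "0 < ln n / n"
      using elim(1) by (intro divide_pos_pos) linarith+
    then have w: "0 < w" "w\<^sup>2 = ln n / n"
      by (simp_all add: w_def)
    have le: "23 * w \<le> p n"
      using elim(2) w(1) by (simp add: w_def[symmetric] field_simps)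
    then have "0 < p n"
      using w(1) by linarith
    moreover have "512 * ln n \<le> n * (p n)\<^sup>2"
    proof -
      have "(23 * w)\<^sup>2 \<le> (p n)\<^sup>2"
        using le w(1) by (intro power_mono) auto
      then have "n * (529 * (ln n / n)) \<le> n * (p n)\<^sup>2"
        using n by (intro mult_left_mono) (simp_all add: power_mult_distrib w(2))
      then show ?thesis
        using n elim(1) by simp
    qed
    ultimately show ?case
      using assms(2) elim(1) by (intro prob_mono_coverable_ge)
  qed
  show "eventually (\<lambda>n. measure_pmf.prob (random_bip_graph n (p n))
      {E. \<forall>c. mono_coverable 3 (bip_verts n) E c} \<le> 1) sequentially"
    by simp
  show "(\<lambda>n. 1 :: real) \<longlonglongrightarrow> 1"
    by simp
qed

end
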